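(* There is an algorithm that solves the Unconstrained $k$-near Chain Addition problem in time $O(n^3 k^{2k+2})$, where $n=|S|+|Q|$.
   Context: The input is a bipartite graph $G=(S\cup Q,E)$ (students $S$, questions $Q$; $sq\in E$ means student $s$ answered question $q$ correctly), a bijection $\alpha:S\to\{1,\dots,|S|\}$ (initial student ordering) and a positive integer $k$. For a vertex $x$, $N(x)$ denotes its neighborhood. An ordering (bijection) $\pi:S\to\{1,\dots,|S|\}$ is nested if $\pi(s_1)\ge \pi(s_2)$ implies $N(s_1)\supseteq N(s_2)$. The Unconstrained $k$-near Chain Addition problem asks for a minimum-size set of edges (student–question pairs) to add to $G$ (no deletions allowed) such that in the resulting graph there is a nested student ordering $\pi$ with $\pi(s)\in[\alpha(s)-k,\alpha(s)+k]$ for all $s\in S$; the questions may be ordered arbitrarily. *)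

theory Defs
  imports Complex_Main
begin

section \<open>The problem\<close>

text \<open>An undirected edge between a student \<open>s\<close> and a question \<open>q\<close> is represented by the pair
  \<open>(s, q)\<close>.\<close>

definition near_chain_instance ::
  "'v set \<Rightarrow> 'v set \<Rightarrow> ('v \<times> 'v) set \<Rightarrow> ('v \<Rightarrow> nat) \<Rightarrow> nat \<Rightarrow> bool" where
  "near_chain_instance S Q E \<alpha> k \<longleftrightarrow>
     finite S \<and> finite Q \<and> S \<inter> Q = {} \<and> E \<subseteq> S \<times> Q \<and>
     bij_betw \<alpha> S {1..card S} \<and> 0 < k"

definition nbhd :: "('v \<times> 'v) set \<Rightarrow> 'v \<Rightarrow> 'v set" where
  "nbhd E x = {y. (x, y) \<in> E \<or> (y, x) \<in> E}"

definition nested_ordering :: "'v set \<Rightarrow> ('v \<times> 'v) set \<Rightarrow> ('v \<Rightarrow> nat) \<Rightarrow> bool" where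
  "nested_ordering S E \<pi> \<longleftrightarrow>
     bij_betw \<pi> S {1..card S} \<and>
     (\<forall>s1\<in>S. \<forall>s2\<in>S. \<pi> s1 \<ge> \<pi> s2 \<longrightarrow> nbhd E s1 \<supseteq> nbhd E s2)"

definition k_near :: "'v set \<Rightarrow> ('v \<Rightarrow> nat) \<Rightarrow> nat \<Rightarrow> ('v \<Rightarrow> nat) \<Rightarrow> bool" where
  "k_near S \<alpha> k \<pi> \<longleftrightarrow>
     (\<forall>s\<in>S. int (\<pi> s) \<in> {int (\<alpha> s) - int k .. int (\<alpha> s) + int k})"

definition near_chain_addition ::
  "'v set \<Rightarrow> 'v set \<Rightarrow> ('v \<times> 'v) set \<Rightarrow> ('v \<Rightarrow> nat) \<Rightarrow> nat \<Rightarrow> ('v \<times> 'v) set \<Rightarrow> bool" where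
  "near_chain_addition S Q E \<alpha> k F \<longleftrightarrow>
     F \<subseteq> S \<times> Q - E \<and> (\<exists>\<pi>. nested_ordering S (E \<union> F) \<pi> \<and> k_near S \<alpha> k \<pi>)"

definition min_near_chain_addition ::
  "'v set \<Rightarrow> 'v set \<Rightarrow> ('v \<times> 'v) set \<Rightarrow> ('v \<Rightarrow> nat) \<Rightarrow> nat \<Rightarrow> ('v \<times> 'v) set \<Rightarrow> bool" where
  "min_near_chain_addition S Q E \<alpha> k F \<longleftrightarrow>
     is_arg_min card (near_chain_addition S Q E \<alpha> k) F"


section \<open>Algorithms and running time\<close>

text \<open>
  Algorithms are programs for a random access machine with structured control flow. The store
  consists of named arrays of natural numbers; a scalar variable is cell \<open>0\<close> of its array. A
  program mentions only finitely many names, so the arrays can be interleaved in a single memory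
  with constant overhead per access. Every operation has unit cost. The only arithmetic
  operations are addition and truncated subtraction: unit-cost multiplication on unbounded numbers
  would make the model unreasonably powerful.
\<close>

type_synonym store = "string \<Rightarrow> nat \<Rightarrow> nat"

datatype exp =
    Const nat
  | Read string exp
  | Plus exp exp
  | Minus exp exp

datatype test =
    Less exp exp
  | Neg test
  | Conj test test

datatype com =
    Skip
  | Assign string exp exp
  | Seq com com
  | Cond test com com
  | While test com

primrec eval_exp :: "exp \<Rightarrow> store \<Rightarrow> nat" where
  "eval_exp (Const c) \<sigma> = c"
| "eval_exp (Read a e) \<sigma> = \<sigma> a (eval_exp e \<sigma>)"
| "eval_exp (Plus e1 e2) \<sigma> = eval_exp e1 \<sigma> + eval_exp e2 \<sigma>"
| "eval_exp (Minus e1 e2) \<sigma> = eval_exp e1 \<sigma> - eval_exp e2 \<sigma>"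

primrec exp_cost :: "exp \<Rightarrow> nat" where
  "exp_cost (Const c) = 1"
| "exp_cost (Read a e) = exp_cost e + 1"
| "exp_cost (Plus e1 e2) = exp_cost e1 + exp_cost e2 + 1"
| "exp_cost (Minus e1 e2) = exp_cost e1 + exp_cost e2 + 1"

primrec eval_test :: "test \<Rightarrow> store \<Rightarrow> bool" where
  "eval_test (Less e1 e2) \<sigma> \<longleftrightarrow> eval_exp e1 \<sigma> < eval_exp e2 \<sigma>"
| "eval_test (Neg b) \<sigma> \<longleftrightarrow> \<not> eval_test b \<sigma>"
| "eval_test (Conj b1 b2) \<sigma> \<longleftrightarrow> eval_test b1 \<sigma> \<and> eval_test b2 \<sigma>"

primrec test_cost :: "test \<Rightarrow> nat" where
  "test_cost (Less e1 e2) = exp_cost e1 + exp_cost e2 + 1"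
| "test_cost (Neg b) = test_cost b + 1"
| "test_cost (Conj b1 b2) = test_cost b1 + test_cost b2 + 1"

text \<open>\<open>exec c \<sigma> t \<tau>\<close>: started in store \<open>\<sigma>\<close>, the program \<open>c\<close> halts after exactly \<open>t\<close> steps in
  store \<open>\<tau>\<close>.\<close>

inductive exec :: "com \<Rightarrow> store \<Rightarrow> nat \<Rightarrow> store \<Rightarrow> bool" where
  exec_Skip: "exec Skip \<sigma> 1 \<sigma>"
| exec_Assign:
    "exec (Assign a i e) \<sigma> (exp_cost i + exp_cost e + 1)
       (\<sigma>(a := (\<sigma> a)(eval_exp i \<sigma> := eval_exp e \<sigma>)))"
| exec_Seq:
    "exec c1 \<sigma> t1 \<rho> \<Longrightarrow> exec c2 \<rho> t2 \<tau> \<Longrightarrow> exec (Seq c1 c2) \<sigma> (t1 + t2) \<tau>"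
| exec_Cond_True:
    "eval_test b \<sigma> \<Longrightarrow> exec c1 \<sigma> t \<tau> \<Longrightarrow> exec (Cond b c1 c2) \<sigma> (test_cost b + t + 1) \<tau>"
| exec_Cond_False:
    "\<not> eval_test b \<sigma> \<Longrightarrow> exec c2 \<sigma> t \<tau> \<Longrightarrow> exec (Cond b c1 c2) \<sigma> (test_cost b + t + 1) \<tau>"
| exec_While_False:
    "\<not> eval_test b \<sigma> \<Longrightarrow> exec (While b c) \<sigma> (test_cost b + 1) \<sigma>"
| exec_While_True:
    "eval_test b \<sigma> \<Longrightarrow> exec c \<sigma> t1 \<rho> \<Longrightarrow> exec (While b c) \<rho> t2 \<tau> \<Longrightarrow>
     exec (While b c) \<sigma> (test_cost b + t1 + t2 + 1) \<tau>"

lemma exec_deterministic: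
  assumes "exec c \<sigma> t \<tau>" and "exec c \<sigma> t' \<tau>'"
  shows "t = t' \<and> \<tau> = \<tau>'"
  using assms
proof (induction arbitrary: t' \<tau>' rule: exec.induct)
  case (exec_Skip \<sigma>)
  then show ?case by (auto elim: exec.cases)
next
  case (exec_Assign a i e \<sigma>)
  then show ?case by (auto elim: exec.cases)
next
  case (exec_Seq c1 \<sigma> t1 \<rho> c2 t2 \<tau>)
  from exec_Seq.prems show ?case
    by cases (use exec_Seq.IH in blast)
next
  case (exec_Cond_True b \<sigma> c1 t \<tau> c2)
  from exec_Cond_True.prems show ?case
    by cases (use exec_Cond_True in blast)+
next
  case (exec_Cond_False b \<sigma> c2 t \<tau> c1)
  from exec_Cond_False.prems show ?case
    by cases (use exec_Cond_False in blast)+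
next
  case (exec_While_False b \<sigma> c)
  from exec_While_False.prems show ?case
    by cases (use exec_While_False in blast)+
next
  case (exec_While_True b \<sigma> c t1 \<rho> t2 \<tau>)
  from exec_While_True.prems show ?case
    by cases (use exec_While_True in blast)+
qed


section \<open>Input and output conventions\<close>

text \<open>
  The lists \<open>xs\<close> and \<open>ys\<close> enumerate the students and the questions, so that vertices can be
  addressed by their indices. The graph is given by its adjacency matrix, stored row by row. All
  cells that hold no input are initially \<open>0\<close>.
\<close>

definition input_store ::
  "'v list \<Rightarrow> 'v list \<Rightarrow> ('v \<times> 'v) set \<Rightarrow> ('v \<Rightarrow> nat) \<Rightarrow> nat \<Rightarrow> store" where
  "input_store xs ys E \<alpha> k = (\<lambda>a i.
     if a = ''students'' \<and> i = 0 then length xs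
     else if a = ''questions'' \<and> i = 0 then length ys
     else if a = ''k'' \<and> i = 0 then k
     else if a = ''alpha'' \<and> i < length xs then \<alpha> (xs ! i)
     else if a = ''adj'' \<and> i < length xs * length ys \<and>
             (xs ! (i div length ys), ys ! (i mod length ys)) \<in> E then 1
     else 0)"

text \<open>The set of added edges is returned as a 0/1-matrix in the same layout.\<close>

definition output_edges :: "'v list \<Rightarrow> 'v list \<Rightarrow> store \<Rightarrow> ('v \<times> 'v) set" where
  "output_edges xs ys \<tau> =
     {(xs ! i, ys ! j) | i j.
        i < length xs \<and> j < length ys \<and> \<tau> ''out'' (i * length ys + j) = 1}"

end

theory Submission
  imports Defs
begin

text \<open>
  For a fixed ordering it is optimal to join each student to every question answered by itself or an
  earlier student. The number of edges is then the sum over \<open>p\<close> of the number of questions covered by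
  the first \<open>p\<close> students, and it depends only on the chain of sets of placed students.
  A \<open>k\<close>-near ordering places every student whose initial position is at most \<open>p - k\<close>, and
  none beyond \<open>p + k\<close>, among the first \<open>p\<close>. So each set of the chain is described by \<open>p\<close> and a mask of
  \<open>2 k\<close> bits, and an optimal chain is a shortest path through a layered graph with \<open>4 ^ k\<close> states per
  layer. Evaluating the cover of every state naively costs a factor \<open>|S| |Q|\<close>, and
  \<open>(k + 1) 4 ^ k\<close> is \<open>O(k ^ (2 k + 2))\<close>.
\<close>

section \<open>Verified bounded loops\<close>

text \<open>Instead of the added edges, all edges of the result are counted: \<open>E\<close>
  contributes a constant, and only the total splits into terms that depend on one state each.
  Correctness and time must be shown for the same concrete program; \<open>runs\<close> decouples
  them. The time is bounded by a number computed from the program text, so invariants speak of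
  stores only and the arithmetic of the bound is done once, for the whole solver. Frame conditions
  are syntactic too, through the names a program can write. As the machine has neither
  multiplication nor shifts, row offsets, powers of two and halves are tabulated by additions. The
  dynamic program records successors rather than covers: replaying an optimal path visits one state
  per layer, so recomputing its covers is cheap.\<close>

primrec writes :: "com \<Rightarrow> string set" where
  "writes Skip = {}"
| "writes (Assign a i e) = {a}"
| "writes (Seq c1 c2) = writes c1 \<union> writes c2"
| "writes (Cond b c1 c2) = writes c1 \<union> writes c2"
| "writes (While b c) = writes c"

definition agree_off :: "string set \<Rightarrow> store \<Rightarrow> store \<Rightarrow> bool" where
  "agree_off W \<sigma> \<tau> \<longleftrightarrow> (\<forall>a. a \<notin> W \<longrightarrow> \<tau> a = \<sigma> a)"

lemma agree_offD: "agree_off W \<sigma> \<tau> \<Longrightarrow> a \<notin> W \<Longrightarrow> \<tau> a = \<sigma> a"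
  by (simp add: agree_off_def)

lemma exec_agree_off: "exec c \<sigma> t \<tau> \<Longrightarrow> agree_off (writes c) \<sigma> \<tau>"
  by (induction rule: exec.induct) (auto simp: agree_off_def)

text \<open>Loops carry no annotation, so the variable to look up in \<open>L\<close> is recovered
  from the shape of the test that \<open>For\<close> produces.\<close>

fun counter :: "test \<Rightarrow> string" where
  "counter (Less (Read v i) e) = v"
| "counter _ = []"

text \<open>\<open>L v\<close> bounds the number of iterations of every loop that is counted by the variable \<open>v\<close>, so that a
  running time can be read off the program text.\<close>

primrec time_bound :: "(string \<Rightarrow> nat) \<Rightarrow> com \<Rightarrow> nat" where
  "time_bound L Skip = 1"
| "time_bound L (Assign a i e) = exp_cost i + exp_cost e + 1"
| "time_bound L (Seq c1 c2) = time_bound L c1 + time_bound L c2"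
| "time_bound L (Cond b c1 c2) = test_cost b + time_bound L c1 + time_bound L c2 + 1"
| "time_bound L (While b c) =
     L (counter b) * (test_cost b + time_bound L c + 1) + test_cost b + 1"

definition runs :: "(string \<Rightarrow> nat) \<Rightarrow> com \<Rightarrow> store \<Rightarrow> (store \<Rightarrow> bool) \<Rightarrow> bool" where
  "runs L c \<sigma> Q \<longleftrightarrow> (\<exists>t \<tau>. exec c \<sigma> t \<tau> \<and> t \<le> time_bound L c \<and> Q \<tau>)"

abbreviation var :: "string \<Rightarrow> exp" where
  "var v \<equiv> Read v (Const 0)"

abbreviation set_var :: "string \<Rightarrow> exp \<Rightarrow> com" where
  "set_var v e \<equiv> Assign v (Const 0) e"

definition For :: "string \<Rightarrow> exp \<Rightarrow> com \<Rightarrow> com" where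
  "For v e c = Seq (set_var v (Const 0))
     (While (Less (var v) e) (Seq c (set_var v (Plus (var v) (Const 1)))))"

lemma writes_For [simp]: "writes (For v e c) = insert v (writes c)"
  by (auto simp: For_def)

text \<open>Each iteration pays \<open>exp_cost e + 3\<close> for the test, 6 for the increment and
  1 for the loop step; initialisation costs 3 and the failing test
  \<open>exp_cost e + 4\<close>.\<close>

lemma time_bound_For [simp]:
  "time_bound L (For v e c) = L v * (exp_cost e + time_bound L c + 10) + exp_cost e + 7"
  by (simp add: For_def algebra_simps)

lemma runs_Skip: "Q \<sigma> \<Longrightarrow> runs L Skip \<sigma> Q"
  unfolding runs_def using exec_Skip by fastforce

lemma runs_Assign:
  "Q (\<sigma>(a := (\<sigma> a)(eval_exp i \<sigma> := eval_exp e \<sigma>))) \<Longrightarrow> runs L (Assign a i e) \<sigma> Q"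
  unfolding runs_def using exec_Assign by fastforce

lemma runs_Seq:
  assumes "runs L c1 \<sigma> (\<lambda>\<rho>. runs L c2 \<rho> Q)"
  shows "runs L (Seq c1 c2) \<sigma> Q"
  using assms unfolding runs_def by (fastforce intro: exec_Seq add_mono)

lemma runs_Cond:
  assumes "eval_test b \<sigma> \<Longrightarrow> runs L c1 \<sigma> Q" and "\<not> eval_test b \<sigma> \<Longrightarrow> runs L c2 \<sigma> Q"
  shows "runs L (Cond b c1 c2) \<sigma> Q"
proof (cases "eval_test b \<sigma>")
  case True
  then obtain t \<tau> where "exec c1 \<sigma> t \<tau>" "t \<le> time_bound L c1" "Q \<tau>"
    using assms(1) by (auto simp: runs_def)
  with exec_Cond_True[OF True, of c1 t \<tau> c2] show ?thesis
    unfolding runs_def by (intro exI[of _ "test_cost b + t + 1"] exI[of _ \<tau>]) simp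
next
  case False
  then obtain t \<tau> where "exec c2 \<sigma> t \<tau>" "t \<le> time_bound L c2" "Q \<tau>"
    using assms(2) by (auto simp: runs_def)
  with exec_Cond_False[OF False, of c2 t \<tau> c1] show ?thesis
    unfolding runs_def by (intro exI[of _ "test_cost b + t + 1"] exI[of _ \<tau>]) simp
qed

lemma runs_conseq:
  assumes "runs L c \<sigma> Q" and "\<And>\<tau>. Q \<tau> \<Longrightarrow> agree_off (writes c) \<sigma> \<tau> \<Longrightarrow> R \<tau>"
  shows "runs L c \<sigma> R"
  using assms exec_agree_off unfolding runs_def by blast

lemma runs_Seq_frame:
  assumes "runs L c1 \<sigma> Q"
    and "\<And>\<rho>. Q \<rho> \<Longrightarrow> agree_off (writes c1) \<sigma> \<rho> \<Longrightarrow> runs L c2 \<rho> R"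
  shows "runs L (Seq c1 c2) \<sigma> R"
  by (rule runs_Seq) (rule runs_conseq[OF assms])

text \<open>The frame is always relative to the store \<sigma> before the loop, not to the current
  store \<rho>. Hence \<open>I\<close> need mention only what the body changes, and the bound
  \<open>e\<close> keeps its value \<open>n\<close>. \<open>I (Suc i)\<close> is asked of the store
  with \<open>v\<close> already increased because the increment follows the body.\<close>

lemma runs_While_upto:
  assumes v: "v \<notin> writes c"
    and bound: "\<And>\<rho>. agree_off (insert v (writes c)) \<sigma> \<rho> \<Longrightarrow> eval_exp e \<rho> = n"
    and step: "\<And>i \<rho>. i < n \<Longrightarrow> I i \<rho> \<Longrightarrow> \<rho> v 0 = i \<Longrightarrow> agree_off (insert v (writes c)) \<sigma> \<rho> \<Longrightarrow>
      runs L c \<rho> (\<lambda>\<tau>. I (Suc i) (\<tau>(v := (\<tau> v)(0 := Suc i))))"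
    and "i \<le> n" and "I i \<rho>" and "\<rho> v 0 = i" and "agree_off (insert v (writes c)) \<sigma> \<rho>"
  shows "\<exists>t \<tau>. exec (While (Less (var v) e) (Seq c (set_var v (Plus (var v) (Const 1))))) \<rho> t \<tau> \<and>
    t \<le> (n - i) * (exp_cost e + time_bound L c + 10) + exp_cost e + 4 \<and>
    I n \<tau> \<and> agree_off (insert v (writes c)) \<sigma> \<tau>"
  using assms(4-)
proof (induction "n - i" arbitrary: i \<rho>)
  case 0
  then have "i = n" and "eval_exp e \<rho> = n"
    using bound by auto
  with 0 have "\<not> eval_test (Less (var v) e) \<rho>"
    by simp
  from exec_While_False[OF this] 0 \<open>i = n\<close> show ?case
    by fastforce
next
  case (Suc d)
  then have "i < n" and e: "eval_exp e \<rho> = n"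
    using bound by auto
  with Suc have tst: "eval_test (Less (var v) e) \<rho>"
    by simp
  from step[OF \<open>i < n\<close>] Suc.prems obtain t1 \<tau>1 where
    1: "exec c \<rho> t1 \<tau>1" "t1 \<le> time_bound L c" "I (Suc i) (\<tau>1(v := (\<tau>1 v)(0 := Suc i)))"
    unfolding runs_def by blast
  define \<rho>' where "\<rho>' = \<tau>1(v := (\<tau>1 v)(0 := Suc i))"
  have a1: "agree_off (writes c) \<rho> \<tau>1"
    using exec_agree_off[OF 1(1)] .
  then have "\<tau>1 v 0 = i"
    using v Suc.prems by (simp add: agree_off_def)
  then have 2: "exec (set_var v (Plus (var v) (Const 1))) \<tau>1 6 \<rho>'"
    using exec_Assign[of v "Const 0" "Plus (var v) (Const 1)" \<tau>1] by (simp add: \<rho>'_def numeral_eq_Suc)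
  have a2: "agree_off (insert v (writes c)) \<sigma> \<rho>'"
    using a1 Suc.prems(4) by (auto simp: agree_off_def \<rho>'_def)
  have "\<exists>t \<tau>. exec (While (Less (var v) e) (Seq c (set_var v (Plus (var v) (Const 1))))) \<rho>' t \<tau> \<and>
    t \<le> (n - Suc i) * (exp_cost e + time_bound L c + 10) + exp_cost e + 4 \<and>
    I n \<tau> \<and> agree_off (insert v (writes c)) \<sigma> \<tau>"
    using Suc.hyps(2) \<open>i < n\<close> 1(3) a2 by (intro Suc.hyps(1)) (auto simp: \<rho>'_def)
  then obtain t2 \<tau> where
    3: "exec (While (Less (var v) e) (Seq c (set_var v (Plus (var v) (Const 1))))) \<rho>' t2 \<tau>"
    and t2: "t2 \<le> (n - Suc i) * (exp_cost e + time_bound L c + 10) + exp_cost e + 4"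
    and fin: "I n \<tau>" "agree_off (insert v (writes c)) \<sigma> \<tau>"
    by blast
  have "n - i = Suc (n - Suc i)"
    using \<open>i < n\<close> by simp
  with t2 1(2) have "test_cost (Less (var v) e) + (t1 + 6) + t2 + 1
    \<le> (n - i) * (exp_cost e + time_bound L c + 10) + exp_cost e + 4"
    by simp
  with exec_While_True[OF tst exec_Seq[OF 1(1) 2] 3] fin show ?case
    by blast
qed

lemma runs_For:
  assumes v: "v \<notin> writes c"
    and bound: "\<And>\<rho>. agree_off (insert v (writes c)) \<sigma> \<rho> \<Longrightarrow> eval_exp e \<rho> = n"
    and "n \<le> L v"
    and init: "I 0 (\<sigma>(v := (\<sigma> v)(0 := 0)))"
    and step: "\<And>i \<rho>. i < n \<Longrightarrow> I i \<rho> \<Longrightarrow> \<rho> v 0 = i \<Longrightarrow> agree_off (insert v (writes c)) \<sigma> \<rho> \<Longrightarrow>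
      runs L c \<rho> (\<lambda>\<tau>. I (Suc i) (\<tau>(v := (\<tau> v)(0 := Suc i))))"
    and post: "\<And>\<tau>. I n \<tau> \<Longrightarrow> agree_off (insert v (writes c)) \<sigma> \<tau> \<Longrightarrow> Q \<tau>"
  shows "runs L (For v e c) \<sigma> Q"
proof -
  let ?\<rho> = "\<sigma>(v := (\<sigma> v)(0 := 0))"
  have "\<exists>t \<tau>. exec (While (Less (var v) e) (Seq c (set_var v (Plus (var v) (Const 1))))) ?\<rho> t \<tau> \<and>
    t \<le> (n - 0) * (exp_cost e + time_bound L c + 10) + exp_cost e + 4 \<and>
    I n \<tau> \<and> agree_off (insert v (writes c)) \<sigma> \<tau>"
    by (rule runs_While_upto[OF v bound step])
      (use init in \<open>auto simp: agree_off_def fun_upd_def\<close>)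
  then obtain t \<tau> where
    2: "exec (While (Less (var v) e) (Seq c (set_var v (Plus (var v) (Const 1))))) ?\<rho> t \<tau>"
    and t: "t \<le> n * (exp_cost e + time_bound L c + 10) + exp_cost e + 4"
    and fin: "I n \<tau>" "agree_off (insert v (writes c)) \<sigma> \<tau>"
    by auto
  have 1: "exec (set_var v (Const 0)) \<sigma> 3 ?\<rho>"
    using exec_Assign[of v "Const 0" "Const 0" \<sigma>] by (simp add: numeral_eq_Suc)
  have "n * (exp_cost e + time_bound L c + 10) \<le> L v * (exp_cost e + time_bound L c + 10)"
    using \<open>n \<le> L v\<close> by (rule mult_le_mono1)
  with t have "3 + t \<le> time_bound L (For v e c)"
    unfolding time_bound_For by linarith
  then show ?thesis
    unfolding runs_def
    by (intro exI[of _ "3 + t"] exI[of _ \<tau>])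
      (use exec_Seq[OF 1 2] post[OF fin] in \<open>simp add: For_def\<close>)
qed

lemmas runs_straight = runs_Seq runs_Assign runs_Cond runs_Skip


section \<open>The program\<close>

text \<open>The scalars \<open>p\<close> and \<open>M\<close> hold the current state of the dynamic program: the number of students placed
  and the mask of the window. The loop runs beyond the \<open>2 k\<close> bits of the window because \<open>mark_members\<close>
  looks up every student position, up to \<open>students + k\<close>.\<close>

definition decode :: com where
  "decode = Seq (set_var ''x'' (var ''M''))
     (For ''j'' (Plus (var ''students'') (Plus (Plus (var ''k'') (var ''k'')) (Const 1)))
       (Seq (set_var ''y'' (Read ''half'' (var ''x'')))
       (Seq (Assign ''bits'' (var ''j'') (Minus (var ''x'') (Plus (var ''y'') (var ''y''))))
            (set_var ''x'' (var ''y'')))))"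

definition mark_members :: com where
  "mark_members = For ''i'' (var ''students'')
     (Seq (set_var ''c'' (Minus (Plus (Read ''alpha'' (var ''i'')) (var ''k'')) (Const 1)))
       (Cond (Less (var ''c'') (var ''p''))
         (Assign ''mem'' (var ''i'') (Const 1))
         (Assign ''mem'' (var ''i'') (Read ''bits'' (Minus (var ''c'') (var ''p''))))))"

text \<open>\<open>mem[i]\<close> says whether student \<open>i\<close> has been placed, and \<open>un[q]\<close> whether some placed student
  is adjacent to question \<open>q\<close>.\<close>

definition test_cover :: com where
  "test_cover = Seq (Assign ''un'' (var ''q'') (Const 0))
     (For ''i'' (var ''students'')
       (Cond (Conj (Less (Const 0) (Read ''mem'' (var ''i'')))
               (Less (Const 0) (Read ''adj'' (Plus (Read ''row'' (var ''i'')) (var ''q'')))))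
         (Assign ''un'' (var ''q'') (Const 1)) Skip))"

definition count_union :: com where
  "count_union = Seq (set_var ''cnt'' (Const 0))
     (For ''q'' (var ''questions'')
       (Seq test_cover (set_var ''cnt'' (Plus (var ''cnt'') (Read ''un'' (var ''q''))))))"

definition analyse :: com where
  "analyse = Seq decode (Seq mark_members count_union)"

text \<open>The entry of \<open>row\<close> just past the last student supplies the product
  \<open>(m + 1) * w\<close> without a multiplication; the value is \<open>penalty\<close>.\<close>

definition infinity :: exp where
  "infinity = Plus (Read ''row'' (Plus (var ''students'') (Const 1))) (Const 1)"

definition start_mask :: exp where
  "start_mask = Minus (Read ''pow'' (var ''k'')) (Const 1)"

text \<open>A zero bit \<open>d\<close> of \<open>M\<close> may be filled if \<open>M + 2 ^ d\<close> is odd: the lowest position of the window must be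
  placed before the window moves on.\<close>

definition best_successor :: com where
  "best_successor =
     Seq (set_var ''best'' infinity)
     (Seq (set_var ''nx'' (Const 0))
     (For ''d'' (Plus (Plus (var ''k'') (var ''k'')) (Const 1))
       (Seq (set_var ''y'' (Plus (var ''M'') (Read ''pow'' (var ''d''))))
       (Seq (set_var ''x'' (Read ''half'' (var ''y'')))
       (Seq (set_var ''v'' (Read ''val'' (Plus (Read ''base'' (Plus (var ''p'') (Const 1))) (var ''x''))))
         (Cond (Conj (Conj (Less (Read ''bits'' (var ''d'')) (Const 1))
                           (Less (Plus (var ''x'') (var ''x'')) (var ''y'')))
                     (Less (var ''v'') (var ''best'')))
           (Seq (set_var ''best'' (var ''v'')) (set_var ''nx'' (var ''x''))) Skip))))))"

definition final_penalty :: com where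
  "final_penalty =
     Cond (Conj (Neg (Less (var ''M'') start_mask)) (Neg (Less start_mask (var ''M''))))
       (set_var ''best'' (Const 0)) (set_var ''best'' infinity)"

definition fill_cell :: com where
  "fill_cell = Seq analyse
     (Seq (Cond (Less (var ''p'') (var ''students'')) best_successor final_penalty)
     (Seq (Assign ''val'' (Plus (Read ''base'' (var ''p'')) (var ''M'')) (Plus (var ''cnt'') (var ''best'')))
          (Assign ''next'' (Plus (Read ''base'' (var ''p'')) (var ''M'')) (var ''nx''))))"

text \<open>Layer \<open>p\<close> needs the values of layer \<open>p + 1\<close>, while
  \<open>For\<close> only counts upwards.\<close>

definition fill_table :: com where
  "fill_table = For ''r'' (Plus (var ''students'') (Const 1))
     (Seq (set_var ''p'' (Minus (var ''students'') (var ''r'')))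
          (For ''M'' (var ''N'') fill_cell))"

definition row_table :: com where
  "row_table = For ''i'' (Plus (var ''students'') (Const 1))
     (Assign ''row'' (Plus (var ''i'') (Const 1)) (Plus (Read ''row'' (var ''i'')) (var ''questions'')))"

definition pow_table :: com where
  "pow_table = Seq (Assign ''pow'' (Const 0) (Const 1))
     (For ''d'' (Plus (var ''k'') (var ''k''))
       (Assign ''pow'' (Plus (var ''d'') (Const 1))
         (Plus (Read ''pow'' (var ''d'')) (Read ''pow'' (var ''d'')))))"

text \<open>Halves are needed up to \<open>2 * N\<close>: a successor is half of
  \<open>M + 2 ^ d\<close>, and with \<open>d\<close> up to \<open>2 * k\<close> this sum can exceed
  \<open>N\<close>.\<close>

definition half_table :: com where
  "half_table = Seq (set_var ''N'' (Read ''pow'' (Plus (var ''k'') (var ''k''))))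
     (For ''h'' (var ''N'')
       (Seq (Assign ''half'' (Plus (var ''h'') (var ''h'')) (var ''h''))
            (Assign ''half'' (Plus (Plus (var ''h'') (var ''h'')) (Const 1)) (var ''h''))))"

definition base_table :: com where
  "base_table = For ''i'' (Plus (var ''students'') (Const 1))
     (Assign ''base'' (Plus (var ''i'') (Const 1)) (Plus (Read ''base'' (var ''i'')) (var ''N'')))"

definition tables :: com where
  "tables = Seq row_table (Seq pow_table (Seq half_table base_table))"

definition all_nonedges :: com where
  "all_nonedges = For ''i'' (var ''students'') (For ''q'' (var ''questions'')
     (Assign ''out'' (Plus (Read ''row'' (var ''i'')) (var ''q''))
        (Minus (Const 1) (Read ''adj'' (Plus (Read ''row'' (var ''i'')) (var ''q''))))))"

definition prune :: com where
  "prune = For ''i'' (var ''students'') (For ''q'' (var ''questions'')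
     (Cond (Conj (Less (Const 0) (Read ''mem'' (var ''i''))) (Less (Read ''un'' (var ''q'')) (Const 1)))
        (Assign ''out'' (Plus (Read ''row'' (var ''i'')) (var ''q'')) (Const 0)) Skip))"

definition follow_path :: com where
  "follow_path = Seq (set_var ''M'' start_mask)
     (For ''p'' (Plus (var ''students'') (Const 1))
       (Seq analyse (Seq prune
         (set_var ''M'' (Read ''next'' (Plus (Read ''base'' (var ''p'')) (var ''M'')))))))"

definition solver :: com where
  "solver = Seq tables (Seq fill_table (Seq all_nonedges follow_path))"


section \<open>Masks and nested orderings\<close>

lemma cell_eq_iff:
  fixes N :: nat
  assumes "x < N" and "y < N"
  shows "p * N + x = p' * N + y \<longleftrightarrow> p = p' \<and> x = y"
proof
  assume eq: "p * N + x = p' * N + y"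
  then have "(p * N + x) div N = (p' * N + y) div N" "(p * N + x) mod N = (p' * N + y) mod N"
    by simp_all
  with assms show "p = p' \<and> x = y"
    by simp
qed simp

section \<open>Windows of positions as binary masks\<close>

definition placed :: "nat \<Rightarrow> nat \<Rightarrow> nat set" where
  "placed p M = {c. c < p \<or> bit M (c - p)}"

text \<open>Fill position \<open>p + j\<close>, require the lowest bit to be set, and drop it as the
  window moves on: one equation expresses all three. The value \<open>j = 2 * k\<close> is the
  position just above the window, which the shift brings inside.\<close>

definition mask_step :: "nat \<Rightarrow> nat \<Rightarrow> nat \<Rightarrow> bool" where
  "mask_step k M M' \<longleftrightarrow> (\<exists>j\<le>2 * k. \<not> bit M j \<and> M + 2 ^ j = 2 * M' + 1)"

lemma bit_add_power:
  fixes M :: nat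
  assumes "\<not> bit M j"
  shows "bit (M + 2 ^ j) i \<longleftrightarrow> bit M i \<or> i = j"
proof -
  have "M + 2 ^ j = or M (2 ^ j)"
    by (rule disjunctive_add) (use assms in \<open>auto simp: bit_exp_iff\<close>)
  then show ?thesis
    by (auto simp: bit_or_iff bit_exp_iff)
qed

lemma bit_double_Suc:
  fixes M :: nat
  shows "bit (2 * M + 1) i \<longleftrightarrow> i = 0 \<or> bit M (i - 1)"
  by (cases i) (auto simp: bit_0 bit_Suc)

lemma mask_step_placed:
  assumes "mask_step k M M'"
  shows "\<exists>c. p \<le> c \<and> c \<le> p + 2 * k \<and> c \<notin> placed p M \<and> placed (Suc p) M' = insert c (placed p M)"
proof -
  obtain j where j: "j \<le> 2 * k" "\<not> bit M j" "M + 2 ^ j = 2 * M' + 1"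
    using assms by (auto simp: mask_step_def)
  have b: "bit M i \<or> i = j \<longleftrightarrow> i = 0 \<or> bit M' (i - 1)" for i
    using bit_add_power[OF j(2), of i] bit_double_Suc[of M' i] j(3) by simp
  have "c \<in> placed (Suc p) M' \<longleftrightarrow> c \<in> insert (p + j) (placed p M)" for c
  proof (cases "c < p")
    case True
    then show ?thesis by (simp add: placed_def)
  next
    case False
    then have "c - p = 0 \<longleftrightarrow> c = p" "c - p - 1 = c - Suc p" "c = p + j \<longleftrightarrow> c - p = j"
      by auto
    with b[of "c - p"] False show ?thesis
      by (auto simp: placed_def less_Suc_eq)
  qed
  then show ?thesis
    using j by (intro exI[of _ "p + j"]) (auto simp: placed_def)
qed

text \<open>The halving makes up for a bit set just above the window, so paths never leave the
  \<open>4 ^ k\<close> tabulated states.\<close>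

lemma mask_step_less:
  assumes "mask_step k M M'" and "M < 4 ^ k"
  shows "M' < 4 ^ k"
proof -
  obtain j where j: "j \<le> 2 * k" "M + 2 ^ j = 2 * M' + 1"
    using assms by (auto simp: mask_step_def)
  have "(2::nat) ^ j \<le> 2 ^ (2 * k)"
    using j(1) by (intro power_increasing) auto
  then have "(2::nat) ^ j \<le> 4 ^ k"
    by (simp add: power_mult)
  with j assms show ?thesis by linarith
qed

text \<open>Converse of \<open>mask_step_placed\<close>. The lowest bit comes for free: position
  \<open>p\<close> belongs to \<open>placed (Suc p) M'\<close>, hence is \<open>c\<close> or was
  placed before.\<close>

lemma mask_step_if_placed:
  assumes "placed (Suc p) M' = insert c (placed p M)" and "c \<notin> placed p M" and "c \<le> p + 2 * k"
  shows "mask_step k M M'"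
proof -
  have c: "p \<le> c" "\<not> bit M (c - p)"
    using assms(2) by (auto simp: placed_def)
  have "M + 2 ^ (c - p) = 2 * M' + 1"
  proof (rule bit_eqI)
    fix i
    have "p + i \<in> placed (Suc p) M' \<longleftrightarrow> p + i = c \<or> p + i \<in> placed p M"
      using assms(1) by auto
    then show "bit (M + 2 ^ (c - p)) i \<longleftrightarrow> bit (2 * M' + 1) i"
      unfolding bit_add_power[OF c(2)] bit_double_Suc using c(1)
      by (cases i) (auto simp: placed_def)
  qed
  with c assms(3) show ?thesis
    unfolding mask_step_def by (intro exI[of _ "c - p"]) auto
qed

text \<open>Filling bit \<open>k\<close> at every step amounts to keeping the order \<alpha>; this
  shows that some path exists and bounds the optimum.\<close>

lemma mask_step_start: "mask_step k (mask k) (mask k)"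
proof -
  have "mask k + 2 ^ k = 2 * mask k + (1::nat)"
    unfolding mask_eq_exp_minus_1 using one_le_power[of "2::nat" k] by linarith
  then show ?thesis
    unfolding mask_step_def by (intro exI[of _ k]) (simp add: bit_mask_iff)
qed

lemma placed_start: "placed p (mask k) = {..<p + k}"
  by (auto simp: placed_def bit_mask_iff)

lemma placed_inject: "placed p M = placed p M' \<longleftrightarrow> M = M'"
proof
  assume eq: "placed p M = placed p M'"
  show "M = M'"
  proof (rule bit_eqI)
    fix i
    have "p + i \<in> placed p M \<longleftrightarrow> p + i \<in> placed p M'"
      using eq by simp
    then show "bit M i \<longleftrightarrow> bit M' i"
      by (simp add: placed_def)
  qed
qed simp

lemma ex_bit_eq:
  assumes "finite X"
  shows "\<exists>M::nat. \<forall>i. bit M i \<longleftrightarrow> i \<in> X"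
  using assms
proof (induction X)
  case empty
  show ?case by (intro exI[of _ 0]) simp
next
  case (insert j X)
  then obtain M :: nat where "\<forall>i. bit M i \<longleftrightarrow> i \<in> X"
    by blast
  with insert(2) show ?case
    by (intro exI[of _ "M + 2 ^ j"]) (simp add: bit_add_power disj_commute)
qed

lemma ex_placed_eq:
  assumes "finite X" and "{..<p} \<subseteq> X"
  shows "\<exists>M. placed p M = X"
proof -
  have "finite {i. p + i \<in> X}"
    using finite_vimageI[OF assms(1), of "(+) p"] by (simp add: vimage_def)
  then obtain M :: nat where M: "\<forall>i. bit M i \<longleftrightarrow> p + i \<in> X"
    using ex_bit_eq by fastforce
  have "c \<in> placed p M \<longleftrightarrow> c \<in> X" for c
    using M assms(2) by (cases "c < p") (auto simp: placed_def)
  then have "placed p M = X"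
    by blast
  then show ?thesis ..
qed

section \<open>Feasible solutions as paths of masks\<close>

locale near_chain =
  fixes S Q :: "'v set" and E :: "('v \<times> 'v) set" and \<alpha> :: "'v \<Rightarrow> nat" and k :: nat
    and xs ys :: "'v list"
  assumes inst: "near_chain_instance S Q E \<alpha> k"
    and xs: "distinct xs" "set xs = S" and ys: "distinct ys" "set ys = Q"
begin

abbreviation m :: nat where "m \<equiv> length xs"
abbreviation w :: nat where "w \<equiv> length ys"

lemma card_S: "card S = m" and card_Q: "card Q = w"
  using xs ys distinct_card by metis+

lemma finite_S: "finite S" and finite_Q: "finite Q" and disjoint: "S \<inter> Q = {}"
  and E_subset: "E \<subseteq> S \<times> Q" and bij_alpha: "bij_betw \<alpha> S {1..m}" and k_pos: "0 < k"
  using inst card_S by (auto simp: near_chain_instance_def)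

text \<open>Positions are shifted by \<open>k - 1\<close>. The positions \<open>0, \<dots>, k - 1\<close> belong to no student; treating
  them as placed from the start makes every window of \<open>2 k\<close> positions contain \<open>k\<close> placed ones.\<close>

definition pos :: "'v \<Rightarrow> nat" where
  "pos s = \<alpha> s + k - 1"

lemma bij_pos: "bij_betw pos S {k..<m + k}"
proof -
  have "bij_betw (\<lambda>a. a + k - 1) {1..m} {k..<m + k}"
    by (rule bij_betw_byWitness[where f' = "\<lambda>c. c + 1 - k"]) auto
  from bij_betw_trans[OF bij_alpha this] show ?thesis
    by (simp add: pos_def[abs_def] comp_def)
qed

lemma pos_eq_iff: "s \<in> S \<Longrightarrow> s' \<in> S \<Longrightarrow> pos s = pos s' \<longleftrightarrow> s = s'"
  using bij_betw_imp_inj_on[OF bij_pos] by (rule inj_on_eq_iff)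

lemma pos_bounds:
  assumes "s \<in> S" shows "k \<le> pos s" "pos s < m + k"
  using bij_betwE[OF bij_pos] assms by fastforce+

definition cover :: "nat \<Rightarrow> nat \<Rightarrow> 'v set" where
  "cover p M = {q\<in>Q. \<exists>s\<in>S. pos s \<in> placed p M \<and> (s, q) \<in> E}"

lemma cover_subset: "cover p M \<subseteq> Q"
  by (auto simp: cover_def)

lemma card_cover_le: "card (cover p M) \<le> w"
  using card_mono[OF finite_Q cover_subset] card_Q by simp

lemma cover_start: "cover 0 (mask k) = {}"
  by (auto simp: cover_def placed_start dest: pos_bounds(1))

definition mask_path :: "(nat \<Rightarrow> nat) \<Rightarrow> bool" where
  "mask_path f \<longleftrightarrow> f 0 = mask k \<and> f m = mask k \<and> (\<forall>p<m. mask_step k (f p) (f (Suc p)))"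

text \<open>The original edges are included. The term for \<open>p = 0\<close> vanishes, so the sum
  over times is a sum over students.\<close>

definition path_cost :: "(nat \<Rightarrow> nat) \<Rightarrow> nat" where
  "path_cost f = (\<Sum>p\<le>m. card (cover p (f p)))"

text \<open>A student that enters at time \<open>p\<close> is joined to all of the cover at time \<open>p\<close>. As the cover grows with
  time, quantifying over all times at which the student is placed gives the same set, and the program
  need not know when each student enters.\<close>

definition path_edges :: "(nat \<Rightarrow> nat) \<Rightarrow> ('v \<times> 'v) set" where
  "path_edges f =
     {(s, q). s \<in> S \<and> q \<in> Q \<and> (s, q) \<notin> E \<and>
        (\<forall>p\<le>m. pos s \<in> placed p (f p) \<longrightarrow> q \<in> cover p (f p))}"

lemma sum_over_ordering:
  assumes "bij_betw \<pi> S {1..m}" and "g 0 = (0::nat)"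
  shows "(\<Sum>s\<in>S. g (\<pi> s)) = (\<Sum>p\<le>m. g p)"
proof -
  have "(\<Sum>s\<in>S. g (\<pi> s)) = sum g {1..m}"
    using sum.reindex_bij_betw[OF assms(1)] .
  also have "\<dots> = sum g {..m}"
    by (rule sum.mono_neutral_left) (use assms(2) in \<open>auto simp: Suc_le_eq\<close>)
  finally show ?thesis by simp
qed

lemma nbhd_student:
  assumes "A \<subseteq> S \<times> Q" and "s \<in> S"
  shows "nbhd A s = {q. (s, q) \<in> A}"
  using assms disjoint by (auto simp: nbhd_def)

lemma card_eq_sum_nbhd:
  assumes "A \<subseteq> S \<times> Q"
  shows "card A = (\<Sum>s\<in>S. card (nbhd A s))"
proof -
  have "A = (SIGMA s:S. nbhd A s)"
    using assms nbhd_student[OF assms] by auto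
  moreover have "finite (nbhd A s)" if "s \<in> S" for s
    using finite_subset[OF _ finite_Q, of "nbhd A s"] nbhd_student[OF assms that] assms by auto
  ultimately show ?thesis
    using card_SigmaI[OF finite_S, of "nbhd A"] by auto
qed

text \<open>A path orders the students by the time at which their positions enter. The new
  neighbourhood of a student is the cover at its entry time, and covers grow along the path.\<close>

lemma path_edges_addition:
  assumes "mask_path f"
  shows "near_chain_addition S Q E \<alpha> k (path_edges f)"
    and "card (E \<union> path_edges f) = path_cost f"
proof -
  let ?P = "\<lambda>p. placed p (f p)"
  have step: "\<exists>c. p \<le> c \<and> c \<le> p + 2 * k \<and> c \<notin> ?P p \<and> ?P (Suc p) = insert c (?P p)" if "p < m" for p
    using mask_step_placed that assms by (simp add: mask_path_def)
  have P0: "?P 0 = {..<k}" and Pm: "?P m = {..<m + k}"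
    using assms by (simp_all add: mask_path_def placed_start)
  have mono_P: "?P p \<subseteq> ?P p'" if "p \<le> p'" "p' \<le> m" for p p'
    using that
  proof (induction p' rule: dec_induct)
    case (step n)
    then show ?case using \<open>\<And>p. p < m \<Longrightarrow> _\<close>[of n] by auto
  qed simp
  have mono_U: "cover p (f p) \<subseteq> cover p' (f p')" if "p \<le> p'" "p' \<le> m" for p p'
    using mono_P[OF that] by (auto simp: cover_def)
  define \<pi> where "\<pi> s = (LEAST p. pos s \<in> ?P p)" for s
  have pi_in: "pos s \<in> ?P (\<pi> s)" and pi_le: "\<pi> s \<le> m" if "s \<in> S" for s
  proof -
    have "pos s \<in> ?P m"
      using Pm pos_bounds(2)[OF that] by simp
    then show "pos s \<in> ?P (\<pi> s)" "\<pi> s \<le> m"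
      unfolding \<pi>_def by (rule LeastI, rule Least_le)
  qed
  have pi_pos: "0 < \<pi> s" if "s \<in> S" for s
    using pi_in[OF that] P0 pos_bounds(1)[OF that] by (cases "\<pi> s") auto
  \<comment> \<open>Since a step inserts a single position, entry at time \<open>\<pi> s\<close>
    identifies the student, which gives injectivity.\<close>
  have pi_last: "pos s \<le> \<pi> s - 1 + 2 * k \<and> \<pi> s - 1 \<le> pos s \<and>
      ?P (\<pi> s) = insert (pos s) (?P (\<pi> s - 1)) \<and> pos s \<notin> ?P (\<pi> s - 1)" if s: "s \<in> S" for s
  proof -
    obtain p where p: "\<pi> s = Suc p"
      using pi_pos[OF s] gr0_implies_Suc by blast
    then have "pos s \<notin> ?P p"
      unfolding \<pi>_def using not_less_Least[of p "\<lambda>p. pos s \<in> ?P p"] by simp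
    with step[of p] p pi_in[OF s] pi_le[OF s] show ?thesis by auto
  qed
  have inj: "inj_on \<pi> S"
  proof (rule inj_onI)
    fix s s' assume s: "s \<in> S" "s' \<in> S" "\<pi> s = \<pi> s'"
    then have "pos s = pos s'"
      using pi_last[OF s(1)] pi_last[OF s(2)] by auto
    with s show "s = s'"
      by (simp add: pos_eq_iff)
  qed
  have "\<pi> ` S \<subseteq> {1..m}"
    using pi_pos pi_le by (auto simp: Suc_le_eq)
  moreover have "card (\<pi> ` S) = card {1..m}"
    using card_image[OF inj] card_S by simp
  ultimately have bij: "bij_betw \<pi> S {1..m}"
    using inj card_subset_eq[of "{1..m}" "\<pi> ` S"] by (simp add: bij_betw_def)
  have sub: "E \<union> path_edges f \<subseteq> S \<times> Q"
    using E_subset by (auto simp: path_edges_def)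
  have nb: "nbhd (E \<union> path_edges f) s = cover (\<pi> s) (f (\<pi> s))" if s: "s \<in> S" for s
  proof -
    have "(s, q) \<in> E \<union> path_edges f \<longleftrightarrow> q \<in> cover (\<pi> s) (f (\<pi> s))" for q
    proof
      assume "(s, q) \<in> E \<union> path_edges f"
      then show "q \<in> cover (\<pi> s) (f (\<pi> s))"
        using pi_in[OF s] pi_le[OF s] s E_subset by (auto simp: path_edges_def cover_def)
    next
      assume q: "q \<in> cover (\<pi> s) (f (\<pi> s))"
      have "q \<in> cover p (f p)" if "p \<le> m" "pos s \<in> ?P p" for p
      proof -
        have "\<pi> s \<le> p"
          unfolding \<pi>_def by (rule Least_le) (rule that(2))
        then show ?thesis using mono_U[of "\<pi> s" p] that q by auto
      qed
      then show "(s, q) \<in> E \<union> path_edges f"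
        using s q cover_subset by (auto simp: path_edges_def)
    qed
    then show ?thesis using nbhd_student[OF sub s] by auto
  qed
  have "nested_ordering S (E \<union> path_edges f) \<pi>"
    unfolding nested_ordering_def using bij card_S nb mono_U pi_le by auto
  moreover have "k_near S \<alpha> k \<pi>"
    unfolding k_near_def
  proof
    fix s assume s: "s \<in> S"
    \<comment> \<open>With \<open>p = \<pi> s - 1\<close> and \<open>c = \<alpha> s + k - 1\<close>,
      the window condition \<open>p \<le> c \<le> p + 2 * k\<close> reads exactly as
      \<open>\<pi> s\<close> and \<open>\<alpha> s\<close> differing by at most
      \<open>k\<close>.\<close>
    have "1 \<le> \<alpha> s"
      using bij_betwE[OF bij_alpha] s by auto
    then show "int (\<pi> s) \<in> {int (\<alpha> s) - int k..int (\<alpha> s) + int k}"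
      using pi_last[OF s] pi_pos[OF s] k_pos by (auto simp: pos_def)
  qed
  moreover have "path_edges f \<subseteq> S \<times> Q - E"
    by (auto simp: path_edges_def)
  ultimately show "near_chain_addition S Q E \<alpha> k (path_edges f)"
    by (auto simp: near_chain_addition_def)
  have "card (E \<union> path_edges f) = (\<Sum>s\<in>S. card (cover (\<pi> s) (f (\<pi> s))))"
    using card_eq_sum_nbhd[OF sub] nb by simp
  also have "\<dots> = path_cost f"
    unfolding path_cost_def using assms cover_start
    by (intro sum_over_ordering[OF bij]) (simp add: mask_path_def)
  finally show "card (E \<union> path_edges f) = path_cost f" .
qed

text \<open>Record the positions placed after each time. Nestedness forces the neighbourhood of a
  student to contain the cover at its time, so the path costs at most as much as the given
  solution.\<close>

lemma addition_to_path:
  assumes "near_chain_addition S Q E \<alpha> k F"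
  shows "\<exists>f. mask_path f \<and> path_cost f \<le> card (E \<union> F)"
proof -
  obtain \<pi> where F: "F \<subseteq> S \<times> Q" and nested: "nested_ordering S (E \<union> F) \<pi>" and near: "k_near S \<alpha> k \<pi>"
    using assms by (auto simp: near_chain_addition_def)
  have bij: "bij_betw \<pi> S {1..m}"
    using nested card_S by (simp add: nested_ordering_def)
  have near': "\<pi> s \<le> \<alpha> s + k" "\<alpha> s \<le> \<pi> s + k" if "s \<in> S" for s
    using near that by (force simp: k_near_def)+
  define X where "X p = {..<k} \<union> pos ` {s\<in>S. \<pi> s \<le> p}" for p
  \<comment> \<open>This uses the bound \<open>\<pi> s \<le> \<alpha> s + k\<close>: a student with
    position \<open>c < p\<close> has \<open>\<alpha> s + k \<le> p\<close>. Only such sets are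
    encodable as \<open>placed p M\<close>.\<close>
  have "{..<p} \<subseteq> X p" if "p \<le> m" for p
  proof
    fix c assume c: "c \<in> {..<p}"
    show "c \<in> X p"
    proof (cases "c < k")
      case False
      with c that have "c \<in> pos ` S"
        using bij_betw_imp_surj_on[OF bij_pos] by auto
      then obtain s where s: "s \<in> S" "c = pos s" by auto
      with c False near'[OF s(1)] show ?thesis
        by (auto simp: X_def pos_def)
    qed (simp add: X_def)
  qed
  moreover have "finite (X p)" for p
    using finite_S by (simp add: X_def)
  ultimately have ex: "\<exists>M. placed p M = X p" if "p \<le> m" for p
    using ex_placed_eq that by simp
  define f where "f p = (SOME M. placed p M = X p)" for p
  have f: "placed p (f p) = X p" if "p \<le> m" for p
    unfolding f_def by (rule someI_ex) (rule ex[OF that])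
  have "{s\<in>S. \<pi> s \<le> 0} = {}" "{s\<in>S. \<pi> s \<le> m} = S"
    using bij_betwE[OF bij] by auto
  then have X0: "X 0 = {..<k}" and "X m = {..<m + k}"
    using bij_betw_imp_surj_on[OF bij_pos] by (auto simp: X_def)
  then have "placed 0 (f 0) = placed 0 (mask k)" "placed m (f m) = placed m (mask k)"
    using f[of 0] f[of m] by (simp_all add: placed_start)
  then have "f 0 = mask k" "f m = mask k"
    by (simp_all only: placed_inject)
  moreover have "mask_step k (f p) (f (Suc p))" if "p < m" for p
  proof -
    have "Suc p \<in> \<pi> ` S"
      using bij_betw_imp_surj_on[OF bij] that by auto
    then obtain s where s: "s \<in> S" "\<pi> s = Suc p" by auto
    have uniq: "s' = s" if "s' \<in> S" "\<pi> s' = Suc p" for s'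
      using inj_onD[OF bij_betw_imp_inj_on[OF bij], of s' s] s that by simp
    have eq: "{s\<in>S. \<pi> s \<le> Suc p} = insert s {s\<in>S. \<pi> s \<le> p}"
      using s by (auto simp: le_Suc_eq intro: uniq)
    have "X (Suc p) = insert (pos s) (X p)"
      unfolding X_def eq by simp
    moreover have "pos s \<notin> X p"
      using s pos_bounds(1)[OF s(1)] by (auto simp: X_def pos_eq_iff)
    \<comment> \<open>Here the other half of nearness enters,
      \<open>\<alpha> s \<le> \<pi> s + k\<close>.\<close>
    moreover have "pos s \<le> p + 2 * k"
      using near'[OF s(1)] s by (simp add: pos_def)
    ultimately show ?thesis
      using f that by (intro mask_step_if_placed[of p _ "pos s"]) auto
  qed
  ultimately have path: "mask_path f"
    by (simp add: mask_path_def)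
  have sub: "E \<union> F \<subseteq> S \<times> Q"
    using F E_subset by auto
  have "cover (\<pi> s) (f (\<pi> s)) \<subseteq> nbhd (E \<union> F) s" if s: "s \<in> S" for s
  proof
    fix q assume q: "q \<in> cover (\<pi> s) (f (\<pi> s))"
    have "\<pi> s \<le> m"
      using bij_betwE[OF bij] s by auto
    with q f obtain s' where s': "s' \<in> S" "pos s' \<in> X (\<pi> s)" "(s', q) \<in> E"
      by (auto simp: cover_def)
    then have "\<pi> s' \<le> \<pi> s"
      using pos_bounds(1)[OF s'(1)] by (auto simp: X_def pos_eq_iff)
    then have "nbhd (E \<union> F) s' \<subseteq> nbhd (E \<union> F) s"
      using nested s s' by (auto simp: nested_ordering_def)
    with s' show "q \<in> nbhd (E \<union> F) s"
      by (auto simp: nbhd_def)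
  qed
  moreover have "finite (nbhd (E \<union> F) s)" if "s \<in> S" for s
    using finite_subset[OF _ finite_Q, of "nbhd (E \<union> F) s"] nbhd_student[OF sub that] sub by auto
  ultimately have "(\<Sum>s\<in>S. card (cover (\<pi> s) (f (\<pi> s)))) \<le> (\<Sum>s\<in>S. card (nbhd (E \<union> F) s))"
    by (intro sum_mono card_mono) auto
  moreover have "(\<Sum>s\<in>S. card (cover (\<pi> s) (f (\<pi> s)))) = path_cost f"
    unfolding path_cost_def using path cover_start
    by (intro sum_over_ordering[OF bij]) (simp add: mask_path_def)
  ultimately show ?thesis
    using card_eq_sum_nbhd[OF sub] path by auto
qed

lemma path_edges_minimal:
  assumes "mask_path f" and "\<And>g. mask_path g \<Longrightarrow> path_cost f \<le> path_cost g"
  shows "min_near_chain_addition S Q E \<alpha> k (path_edges f)"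
proof -
  have card_Un: "card (E \<union> F) = card E + card F" if "F \<subseteq> S \<times> Q - E" for F
    using that E_subset finite_S finite_Q
    by (intro card_Un_disjoint) (auto intro: finite_subset[of _ "S \<times> Q"])
  have "card (path_edges f) \<le> card F" if F: "near_chain_addition S Q E \<alpha> k F" for F
  proof -
    obtain g where "mask_path g" "path_cost g \<le> card (E \<union> F)"
      using addition_to_path[OF F] by auto
    with assms(2) path_edges_addition(2)[OF assms(1)]
    have "card (E \<union> path_edges f) \<le> card (E \<union> F)"
      by fastforce
    then show ?thesis
      using card_Un[of F] card_Un[of "path_edges f"] F path_edges_addition(1)[OF assms(1)]
      by (auto simp: near_chain_addition_def)
  qed
  then show ?thesis
    using path_edges_addition(1)[OF assms(1)]
    by (auto simp: min_near_chain_addition_def is_arg_min_linorder)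
qed

section \<open>Backward recursion for the cheapest path\<close>

text \<open>The penalty exceeds the cost of every path, so it serves as the value infinity.\<close>

definition penalty :: nat where
  "penalty = (m + 1) * w + 1"

text \<open>The argument \<open>r\<close> counts the steps still to come, so the current layer is
  \<open>m - r\<close>. Inserting \<open>penalty\<close> keeps \<open>Min\<close> meaningful for
  every mask and mirrors the initial value of \<open>best\<close> in the program.\<close>

primrec best_cost :: "nat \<Rightarrow> nat \<Rightarrow> nat" where
  "best_cost 0 M = card (cover m M) + (if M = mask k then 0 else penalty)"
| "best_cost (Suc r) M = card (cover (m - Suc r) M) +
     Min (insert penalty (best_cost r ` {M'. mask_step k M M'}))"

lemma finite_mask_steps: "finite {M'. mask_step k M M'}"
proof (rule finite_subset)
  show "{M'. mask_step k M M'} \<subseteq> {..M + 2 ^ (2 * k)}"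
  proof
    fix M' assume "M' \<in> {M'. mask_step k M M'}"
    then obtain j where j: "j \<le> 2 * k" "M + 2 ^ j = 2 * M' + 1"
      by (auto simp: mask_step_def)
    from j(1) have "(2::nat) ^ j \<le> 2 ^ (2 * k)"
      by (intro power_increasing) auto
    with j(2) have "M' \<le> M + 2 ^ (2 * k)"
      by linarith
    then show "M' \<in> {..M + 2 ^ (2 * k)}"
      by simp
  qed
qed simp

lemma best_cost_le:
  assumes "f m = mask k" and "\<And>p. p < m \<Longrightarrow> mask_step k (f p) (f (Suc p))" and "r \<le> m"
  shows "best_cost r (f (m - r)) \<le> (\<Sum>p=m - r..m. card (cover p (f p)))"
  using assms(3)
proof (induction r)
  case 0
  then show ?case using assms(1) by simp
next
  case (Suc r)
  have eq: "m - r = Suc (m - Suc r)"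
    using Suc.prems by simp
  have "mask_step k (f (m - Suc r)) (f (m - r))"
    using assms(2)[of "m - Suc r"] Suc.prems eq by simp
  then have "Min (insert penalty (best_cost r ` {M'. mask_step k (f (m - Suc r)) M'}))
      \<le> best_cost r (f (m - r))"
    using finite_mask_steps by (intro Min_le) auto
  also have "\<dots> \<le> (\<Sum>p=m - r..m. card (cover p (f p)))"
    using Suc by simp
  finally have "best_cost (Suc r) (f (m - Suc r))
      \<le> card (cover (m - Suc r) (f (m - Suc r))) + (\<Sum>p=m - r..m. card (cover p (f p)))"
    by simp
  also have "\<dots> = (\<Sum>p=m - Suc r..m. card (cover p (f p)))"
    unfolding eq by (rule sum.atLeast_Suc_atMost[symmetric]) simp
  finally show ?case .
qed

lemma best_cost_le_path_cost:
  assumes "mask_path f"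
  shows "best_cost m (mask k) \<le> path_cost f"
  using best_cost_le[of f m] assms by (simp add: mask_path_def path_cost_def atMost_atLeast0)

text \<open>The path that keeps the order \<alpha> has \<open>m + 1\<close> terms of at most
  \<open>w\<close> each, hence the choice of \<open>penalty\<close>.\<close>

lemma best_cost_start: "best_cost m (mask k) < penalty"
proof -
  have "mask_path (\<lambda>_. mask k)"
    using mask_step_start by (simp add: mask_path_def)
  then have "best_cost m (mask k) \<le> path_cost (\<lambda>_. mask k)"
    by (rule best_cost_le_path_cost)
  also have "\<dots> \<le> (\<Sum>p\<le>m. w)"
    unfolding path_cost_def by (intro sum_mono card_cover_le)
  also have "\<dots> < penalty"
    by (simp add: penalty_def)
  finally show ?thesis .
qed

text \<open>Conditional, because a state whose value reaches \<open>penalty\<close> may have no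
  successor attaining it; such states are never met when following an optimal path.\<close>

definition good_successor :: "nat \<Rightarrow> nat \<Rightarrow> nat \<Rightarrow> bool" where
  "good_successor p M M' \<longleftrightarrow> (best_cost (m - p) M < penalty \<longrightarrow> mask_step k M M' \<and>
     best_cost (m - p) M = card (cover p M) + best_cost (m - Suc p) M')"

fun follow :: "(nat \<Rightarrow> nat \<Rightarrow> nat) \<Rightarrow> nat \<Rightarrow> nat" where
  "follow nx 0 = mask k"
| "follow nx (Suc p) = nx p (follow nx p)"

lemma follow_optimal:
  assumes nx: "\<And>p M. p < m \<Longrightarrow> M < 4 ^ k \<Longrightarrow> good_successor p M (nx p M)"
  shows "mask_path (follow nx)"
    and "mask_path g \<Longrightarrow> path_cost (follow nx) \<le> path_cost g"
    and "p \<le> m \<Longrightarrow> follow nx p < 4 ^ k"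
proof -
  let ?f = "follow nx"
  have "(2::nat) ^ k \<le> 2 ^ (2 * k)"
    by (intro power_increasing) auto
  then have start: "mask k < (4::nat) ^ k"
    using one_le_power[of "2::nat" k] by (simp add: power_mult mask_eq_exp_minus_1 less_eq_Suc_le)
  \<comment> \<open>Cost paid so far plus value of the current state stays equal to the optimum, and
    the value stays below \<open>penalty\<close>, so the recorded successor can be trusted.\<close>
  have inv: "?f p < 4 ^ k \<and> best_cost (m - p) (?f p) < penalty \<and>
      best_cost m (mask k) = (\<Sum>p<p. card (cover p (?f p))) + best_cost (m - p) (?f p) \<and>
      (\<forall>p'<p. mask_step k (?f p') (?f (Suc p')))" if "p \<le> m" for p
    using that
  proof (induction p)
    case 0
    then show ?case using start best_cost_start by simp
  next
    case (Suc p)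
    then have IH: "?f p < 4 ^ k" "best_cost (m - p) (?f p) < penalty"
      "best_cost m (mask k) = (\<Sum>p<p. card (cover p (?f p))) + best_cost (m - p) (?f p)"
      "\<forall>p'<p. mask_step k (?f p') (?f (Suc p'))"
      by auto
    with nx[of p "?f p"] Suc.prems have "mask_step k (?f p) (?f (Suc p))"
      "best_cost (m - p) (?f p) = card (cover p (?f p)) + best_cost (m - Suc p) (?f (Suc p))"
      by (auto simp: good_successor_def)
    with IH mask_step_less show ?case
      by (auto simp: less_Suc_eq)
  qed
  show "p \<le> m \<Longrightarrow> ?f p < 4 ^ k"
    using inv by blast
  \<comment> \<open>At layer \<open>m\<close> a value below \<open>penalty\<close> excludes every
    mask but \<open>mask k\<close>.\<close>
  from inv[of m] have end_mask: "?f m = mask k"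
    by (auto split: if_splits)
  with inv[of m] show path: "mask_path ?f"
    by (auto simp: mask_path_def)
  have "path_cost ?f = best_cost m (mask k)"
    using inv[of m] end_mask by (simp add: path_cost_def lessThan_Suc_atMost[symmetric])
  then show "mask_path g \<Longrightarrow> path_cost ?f \<le> path_cost g"
    using best_cost_le_path_cost by simp
qed


section \<open>Correctness of the program\<close>

definition limit :: "string \<Rightarrow> nat" where
  "limit v = (if v = ''q'' then w else if v = ''j'' then m + (k + k + 1)
     else if v = ''d'' then k + k + 1 else if v = ''M'' \<or> v = ''h'' then 4 ^ k else m + 1)"

lemma limit_simps [simp]:
  "limit ''q'' = w" "limit ''j'' = m + (k + k + 1)" "limit ''d'' = k + k + 1"
  "limit ''M'' = 4 ^ k" "limit ''h'' = 4 ^ k" "limit ''i'' = m + 1" "limit ''r'' = m + 1"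
  "limit ''p'' = m + 1"
  by (simp_all add: limit_def)

definition input_ok :: "store \<Rightarrow> bool" where
  "input_ok \<sigma> \<longleftrightarrow> \<sigma> ''students'' 0 = m \<and> \<sigma> ''questions'' 0 = w \<and> \<sigma> ''k'' 0 = k \<and>
     (\<forall>i<m. \<sigma> ''alpha'' i = \<alpha> (xs ! i)) \<and>
     (\<forall>i<m. \<forall>q<w. \<sigma> ''adj'' (i * w + q) = of_bool ((xs ! i, ys ! q) \<in> E))"

definition tables_ok :: "store \<Rightarrow> bool" where
  "tables_ok \<sigma> \<longleftrightarrow> (\<forall>i\<le>m + 1. \<sigma> ''row'' i = i * w) \<and> (\<forall>i\<le>2 * k. \<sigma> ''pow'' i = 2 ^ i) \<and>
     \<sigma> ''N'' 0 = 4 ^ k \<and> (\<forall>x<2 * 4 ^ k. \<sigma> ''half'' x = x div 2) \<and>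
     (\<forall>i\<le>m + 1. \<sigma> ''base'' i = i * 4 ^ k)"

abbreviation env_arrays :: "string set" where
  "env_arrays \<equiv> {''students'', ''questions'', ''k'', ''alpha'', ''adj'', ''row'', ''pow'', ''N'', ''half'', ''base''}"

definition env :: "store \<Rightarrow> bool" where
  "env \<sigma> \<longleftrightarrow> input_ok \<sigma> \<and> tables_ok \<sigma>"

lemma env_simps:
  assumes "env \<sigma>"
  shows "\<sigma> ''students'' 0 = m" "\<sigma> ''questions'' 0 = w" "\<sigma> ''k'' 0 = k" "\<sigma> ''N'' 0 = 4 ^ k"
    "i < m \<Longrightarrow> \<sigma> ''alpha'' i = \<alpha> (xs ! i)"
    "i < m \<Longrightarrow> q < w \<Longrightarrow> \<sigma> ''adj'' (i * w + q) = of_bool ((xs ! i, ys ! q) \<in> E)"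
    "i \<le> m + 1 \<Longrightarrow> \<sigma> ''row'' i = i * w" "i \<le> 2 * k \<Longrightarrow> \<sigma> ''pow'' i = 2 ^ i"
    "x < 2 * 4 ^ k \<Longrightarrow> \<sigma> ''half'' x = x div 2" "i \<le> m + 1 \<Longrightarrow> \<sigma> ''base'' i = i * 4 ^ k"
  using assms by (simp_all add: env_def input_ok_def tables_ok_def)

text \<open>Input and tables are read-only once built, so \<open>env\<close> is recovered from the
  frame after any later piece of program.\<close>

lemma env_agree:
  assumes "agree_off W \<sigma> \<tau>" and "W \<inter> env_arrays = {}" and "env \<sigma>"
  shows "env \<tau>"
proof -
  have eq: "\<tau> a = \<sigma> a" if "a \<in> env_arrays" for a
    using agree_offD[OF assms(1)] assms(2) that by blast
  show ?thesis
    using assms(3) unfolding env_def input_ok_def tables_ok_def by (simp add: eq)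
qed

lemma env_upd [simp]:
  assumes "a \<notin> env_arrays"
  shows "env (\<sigma>(a := f)) \<longleftrightarrow> env \<sigma>"
proof
  have off: "{a} \<inter> env_arrays = {}"
    using assms by blast
  show "env \<sigma>" if "env (\<sigma>(a := f))"
    by (rule env_agree[OF _ off that]) (simp add: agree_off_def)
  show "env (\<sigma>(a := f))" if "env \<sigma>"
    by (rule env_agree[OF _ off that]) (simp add: agree_off_def)
qed

section \<open>Evaluating a single state\<close>

lemma runs_decode:
  assumes "env \<sigma>" and "\<sigma> ''M'' 0 = M" and "M < 4 ^ k"
  shows "runs limit decode \<sigma> (\<lambda>\<tau>. \<forall>j\<le>m + 2 * k. \<tau> ''bits'' j = of_bool (bit M j))"
  unfolding decode_def
proof (intro runs_Seq runs_Assign, rule runs_For[where n = "m + 2 * k + 1"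
      and I = "\<lambda>j \<rho>. \<rho> ''x'' 0 = M div 2 ^ j \<and> (\<forall>j'<j. \<rho> ''bits'' j' = of_bool (bit M j'))"], goal_cases)
  case (2 \<rho>)
  then have "env \<rho>" by (rule env_agree) (use assms in auto)
  then show ?case by (simp add: env_simps)
next
  case (5 j \<rho>)
  from 5(4) have env: "env \<rho>" by (rule env_agree) (use assms in auto)
  define x where "x = M div 2 ^ j"
  have "x < 2 * 4 ^ k"
    using assms(3) div_le_dividend[of M "2 ^ j"] unfolding x_def by linarith
  \<comment> \<open>Subtracting twice the tabulated half yields the parity of \<open>x\<close>,
    which is bit \<open>j\<close> of \<open>M\<close>.\<close>
  moreover have "x - (x div 2 + x div 2) = of_bool (bit M j)"
    unfolding bit_iff_odd x_def[symmetric] by (cases "even x") (auto elim!: evenE oddE)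
  moreover have "M div (2 * 2 ^ j) = x div 2"
    unfolding x_def by (simp add: div_mult2_eq mult.commute[of 2])
  moreover have "\<rho> ''x'' 0 = x" "\<forall>j'<j. \<rho> ''bits'' j' = of_bool (bit M j')"
    using 5(2) by (simp_all add: x_def)
  ultimately show ?case
    using 5(3) env by (intro runs_straight) (auto simp: env_simps less_Suc_eq)
qed (use assms in auto)

lemma runs_mark_members:
  assumes "env \<sigma>" and "\<sigma> ''p'' 0 = p" and "\<forall>j\<le>m + 2 * k. \<sigma> ''bits'' j = of_bool (bit M j)"
  shows "runs limit mark_members \<sigma> (\<lambda>\<tau>. \<forall>i<m. \<tau> ''mem'' i = of_bool (pos (xs ! i) \<in> placed p M))"
  unfolding mark_members_def
proof (rule runs_For[where n = m
      and I = "\<lambda>i \<rho>. \<forall>i'<i. \<rho> ''mem'' i' = of_bool (pos (xs ! i') \<in> placed p M)"], goal_cases)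
  case (2 \<rho>)
  then have "env \<rho>" by (rule env_agree) (use assms in auto)
  then show ?case by (simp add: env_simps)
next
  case (5 i \<rho>)
  from 5(4) have env: "env \<rho>" by (rule env_agree) (use assms in auto)
  have at_i: "\<alpha> (xs ! i) + k - Suc 0 = pos (xs ! i)"
    "pos (xs ! i) \<in> placed p M \<longleftrightarrow> pos (xs ! i) < p \<or> bit M (pos (xs ! i) - p)"
    by (simp_all add: pos_def placed_def)
  \<comment> \<open>Keeps the index \<open>pos (xs ! i) - p\<close> within the decoded bits.\<close>
  have "pos (xs ! i) < m + k"
    using pos_bounds(2)[of "xs ! i"] xs 5(1) by auto
  moreover have "\<rho> ''p'' 0 = p" "\<forall>j\<le>m + 2 * k. \<rho> ''bits'' j = of_bool (bit M j)"
    using assms(2,3) agree_offD[OF 5(4)] by simp_all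
  ultimately show ?case
    using 5(1-3) env by (intro runs_straight) (auto simp: env_simps less_Suc_eq at_i)
qed (use assms in auto)

lemma nth_ys_in_cover:
  assumes "q < w"
  shows "ys ! q \<in> cover p M \<longleftrightarrow> (\<exists>i<m. pos (xs ! i) \<in> placed p M \<and> (xs ! i, ys ! q) \<in> E)"
proof -
  have "ys ! q \<in> Q"
    using assms ys(2) by auto
  moreover have "(\<exists>s\<in>S. P s) \<longleftrightarrow> (\<exists>i<m. P (xs ! i))" for P
    unfolding xs(2)[symmetric] set_conv_nth by auto
  ultimately show ?thesis
    by (simp add: cover_def)
qed

lemma card_cover_eq_sum: "card (cover p M) = (\<Sum>q<w. of_bool (ys ! q \<in> cover p M))"
proof -
  have "bij_betw ((!) ys) {..<w} Q"
    using bij_betw_nth[OF ys(1) refl ys(2)[symmetric]] .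
  then have "(\<Sum>q<w. of_bool (ys ! q \<in> cover p M)) = (\<Sum>q\<in>Q. of_bool (q \<in> cover p M))"
    by (rule sum.reindex_bij_betw)
  also have "\<dots> = card (Q \<inter> cover p M)"
    using finite_Q by (simp add: of_bool_def sum.If_cases)
  also have "Q \<inter> cover p M = cover p M"
    using cover_subset by auto
  finally show ?thesis by simp
qed

lemma writes_test_cover [simp]: "writes test_cover = {''un'', ''i''}"
  by (auto simp: test_cover_def)

text \<open>Stated as an update of the whole array \<open>un\<close>, so that the loop over
  questions retains its earlier entries.\<close>

lemma runs_test_cover:
  assumes "env \<sigma>" and "\<forall>i<m. \<sigma> ''mem'' i = of_bool (pos (xs ! i) \<in> placed p M)"
    and "\<sigma> ''q'' 0 = q" and "q < w"
  shows "runs limit test_cover \<sigma> (\<lambda>\<tau>. \<tau> ''un'' = (\<sigma> ''un'')(q := of_bool (ys ! q \<in> cover p M)))"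
  unfolding test_cover_def nth_ys_in_cover[OF assms(4)]
proof (intro runs_Seq runs_Assign, rule runs_For[where n = m
      and I = "\<lambda>i \<tau>. \<tau> ''un'' = (\<sigma> ''un'')(q := of_bool
        (\<exists>i'<i. pos (xs ! i') \<in> placed p M \<and> (xs ! i', ys ! q) \<in> E))"], goal_cases)
  case (2 \<rho>)
  then have "env \<rho>" by (rule env_agree) (use assms in auto)
  then show ?case by (simp add: env_simps)
next
  case (5 i \<rho>)
  from 5(4) have "env \<rho>" by (rule env_agree) (use assms in auto)
  moreover have "\<rho> ''mem'' i = of_bool (pos (xs ! i) \<in> placed p M)" "\<rho> ''q'' 0 = q"
    using assms(2,3) 5(1) agree_offD[OF 5(4)] by simp_all
  ultimately show ?case
    using 5(1-3) assms(4) by (intro runs_straight) (auto simp: env_simps less_Suc_eq)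
qed (use assms in auto)

lemma writes_count_union [simp]: "writes count_union = {''cnt'', ''q'', ''un'', ''i''}"
  by (auto simp: count_union_def)

lemma runs_count_union:
  assumes "env \<sigma>" and "\<forall>i<m. \<sigma> ''mem'' i = of_bool (pos (xs ! i) \<in> placed p M)"
  shows "runs limit count_union \<sigma>
    (\<lambda>\<tau>. (\<forall>q<w. \<tau> ''un'' q = of_bool (ys ! q \<in> cover p M)) \<and> \<tau> ''cnt'' 0 = card (cover p M))"
  unfolding count_union_def
proof (intro runs_Seq runs_Assign, rule runs_For[where n = w
      and I = "\<lambda>q \<rho>. (\<forall>q'<q. \<rho> ''un'' q' = of_bool (ys ! q' \<in> cover p M)) \<and>
        \<rho> ''cnt'' 0 = (\<Sum>q'<q. of_bool (ys ! q' \<in> cover p M))"], goal_cases)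
  case (2 \<rho>)
  then have "env \<rho>" by (rule env_agree) (use assms in auto)
  then show ?case by (simp add: env_simps)
next
  case (5 q \<rho>)
  from 5(4) have env: "env \<rho>" by (rule env_agree) (use assms in auto)
  have mem: "\<forall>i<m. \<rho> ''mem'' i = of_bool (pos (xs ! i) \<in> placed p M)"
    using assms(2) agree_offD[OF 5(4)] by simp
  show ?case
  proof (rule runs_Seq_frame[OF runs_test_cover[OF env mem 5(3,1)]], rule runs_Assign, goal_cases)
    case (1 \<tau>)
    have "\<tau> ''q'' 0 = q" "\<tau> ''cnt'' 0 = \<rho> ''cnt'' 0"
      using 5(3) agree_offD[OF 1(2)] by simp_all
    with 1(1) 5(2) show ?case
      by (auto simp: less_Suc_eq)
  qed
qed (use assms in \<open>auto simp: card_cover_eq_sum\<close>)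

lemma writes_decode [simp]: "writes decode = {''x'', ''j'', ''y'', ''bits''}"
  and writes_mark_members [simp]: "writes mark_members = {''i'', ''c'', ''mem''}"
  by (auto simp: decode_def mark_members_def)

lemma writes_analyse [simp]:
  "writes analyse = {''x'', ''j'', ''y'', ''bits'', ''i'', ''c'', ''mem'', ''cnt'', ''q'', ''un''}"
  by (auto simp: analyse_def)

definition analysed :: "nat \<Rightarrow> nat \<Rightarrow> store \<Rightarrow> bool" where
  "analysed p M \<sigma> \<longleftrightarrow> (\<forall>j\<le>m + 2 * k. \<sigma> ''bits'' j = of_bool (bit M j)) \<and>
     (\<forall>i<m. \<sigma> ''mem'' i = of_bool (pos (xs ! i) \<in> placed p M)) \<and>
     (\<forall>q<w. \<sigma> ''un'' q = of_bool (ys ! q \<in> cover p M)) \<and> \<sigma> ''cnt'' 0 = card (cover p M)"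

lemma runs_analyse:
  assumes "env \<sigma>" and "\<sigma> ''M'' 0 = M" and "\<sigma> ''p'' 0 = p" and "M < 4 ^ k"
  shows "runs limit analyse \<sigma> (analysed p M)"
  unfolding analyse_def
proof (rule runs_Seq_frame[OF runs_decode[OF assms(1,2,4)]], goal_cases)
  case (1 \<rho>)
  have env: "env \<rho>"
    using 1(2) by (rule env_agree) (use assms in auto)
  have p: "\<rho> ''p'' 0 = p"
    using agree_offD[OF 1(2)] assms(3) by simp
  show ?case
  proof (rule runs_Seq_frame[OF runs_mark_members[OF env p 1(1)]], goal_cases)
    case mem: (1 \<tau>)
    have env': "env \<tau>"
      using mem(2) by (rule env_agree) (use env in auto)
    show ?case
    proof (rule runs_conseq[OF runs_count_union[OF env' mem(1)]], goal_cases)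
      case un: (1 \<upsilon>)
      have "\<upsilon> ''bits'' = \<rho> ''bits''" "\<upsilon> ''mem'' = \<tau> ''mem''"
        using agree_offD[OF mem(2)] agree_offD[OF un(2)] by simp_all
      with 1(1) mem(1) un(1) show ?case
        by (simp add: analysed_def)
    qed
  qed
qed

lemma writes_best_successor [simp]:
  "writes best_successor = {''best'', ''nx'', ''d'', ''y'', ''x'', ''v''}"
  and writes_final_penalty [simp]: "writes final_penalty = {''best''}"
  by (auto simp: best_successor_def final_penalty_def)

lemma eval_infinity: "env \<sigma> \<Longrightarrow> eval_exp infinity \<sigma> = penalty"
  by (simp add: infinity_def penalty_def env_simps)

lemma eval_start_mask: "env \<sigma> \<Longrightarrow> eval_exp start_mask \<sigma> = mask k"
  by (simp add: start_mask_def env_simps mask_eq_exp_minus_1)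

lemma runs_best_successor:
  assumes env: "env \<sigma>" and M: "\<sigma> ''M'' 0 = M" "M < 4 ^ k" and p: "\<sigma> ''p'' 0 = p" "p < m"
    and bits: "\<forall>j\<le>m + 2 * k. \<sigma> ''bits'' j = of_bool (bit M j)"
    and val: "\<forall>M'<4 ^ k. \<sigma> ''val'' (Suc p * 4 ^ k + M') = best_cost (m - Suc p) M'"
  shows "runs limit best_successor \<sigma> (\<lambda>\<tau>. card (cover p M) + \<tau> ''best'' 0 = best_cost (m - p) M \<and>
    good_successor p M (\<tau> ''nx'' 0))"
proof -
  let ?c = "best_cost (m - Suc p)"
  \<comment> \<open>Running minimum over the bits below \<open>d\<close>, capped by
    \<open>penalty\<close>; \<open>nx\<close> is a witness as soon as the cap has been
    beaten.\<close>
  let ?I = "\<lambda>d \<rho>. \<rho> ''best'' 0 \<le> penalty \<and>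
    (\<forall>j<d. \<not> bit M j \<and> odd (M + 2 ^ j) \<longrightarrow> \<rho> ''best'' 0 \<le> ?c ((M + 2 ^ j) div 2)) \<and>
    (\<rho> ''best'' 0 < penalty \<longrightarrow> mask_step k M (\<rho> ''nx'' 0) \<and> \<rho> ''best'' 0 = ?c (\<rho> ''nx'' 0))"
  show ?thesis
    unfolding best_successor_def
  proof (intro runs_Seq runs_Assign, rule runs_For[where n = "2 * k + 1" and I = ?I], goal_cases)
    case (2 \<rho>)
    then have "env \<rho>" by (rule env_agree) (use env in auto)
    then show ?case by (simp add: env_simps)
  next
    case (5 d \<rho>)
    from 5(4) have env': "env \<rho>" by (rule env_agree) (use env in auto)
    define y where "y = M + 2 ^ d"
    have pow: "\<rho> ''pow'' d = 2 ^ d"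
      using 5(1) env' by (simp add: env_simps)
    have "(2::nat) ^ d \<le> 2 ^ (2 * k)"
      using 5(1) by (intro power_increasing) auto
    then have "y < 2 * 4 ^ k"
      using M(2) by (simp add: y_def power_mult)
    then have half: "\<rho> ''half'' y = y div 2" and "y div 2 < 4 ^ k"
      using env' by (simp_all add: env_simps)
    have base: "\<rho> ''base'' (Suc p) = Suc p * 4 ^ k"
      using env' p(2) by (simp add: env_simps)
    have val': "\<rho> ''val'' (Suc p * 4 ^ k + y div 2) = ?c (y div 2)"
      using val \<open>y div 2 < 4 ^ k\<close> agree_offD[OF 5(4)] by simp
    have state: "\<rho> ''M'' 0 = M" "\<rho> ''p'' 0 = p" "\<rho> ''bits'' d = of_bool (bit M d)"
      using M(1) p(1) bits 5(1) agree_offD[OF 5(4)] by simp_all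
    \<comment> \<open>The machine tests oddness by comparing \<open>y\<close> with twice its
      half.\<close>
    have odd: "y div 2 + y div 2 < y \<longleftrightarrow> odd y"
      by presburger
    have step: "mask_step k M (y div 2)" if "\<not> bit M d" "odd y"
      unfolding mask_step_def using that 5(1)
      by (intro exI[of _ d]) (auto simp: y_def[symmetric])
    show ?case
    proof (intro runs_straight, goal_cases)
      case 1
      have "\<not> bit M d" "odd y" "?c (y div 2) < \<rho> ''best'' 0"
        using 1 by (simp_all add: state 5(3) pow half base val' odd y_def[symmetric] del: mult_Suc split: if_splits)
      with step 5(2) show ?case
        by (auto simp: state 5(3) pow half base val' y_def[symmetric] less_Suc_eq simp del: mult_Suc)
    next
      case 2
      have "\<not> bit M d \<and> odd y \<longrightarrow> \<rho> ''best'' 0 \<le> ?c (y div 2)"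
        using 2 by (auto simp: state 5(3) pow half base val' odd y_def[symmetric] simp del: mult_Suc)
      with 5(2) show ?case
        by (auto simp: y_def less_Suc_eq)
    qed
  next
    case (6 \<tau>)
    have r: "m - p = Suc (m - Suc p)"
      using p(2) by simp
    \<comment> \<open>Recasts successors as what the loop enumerates: bits \<open>j\<close> that are
      free and make the sum odd, with the half as the new mask.\<close>
    have step_iff: "mask_step k M M' \<longleftrightarrow>
        (\<exists>j<2 * k + 1. (\<not> bit M j \<and> odd (M + 2 ^ j)) \<and> M' = (M + 2 ^ j) div 2)" for M'
    proof -
      have "M + 2 ^ j = 2 * M' + 1 \<longleftrightarrow> odd (M + 2 ^ j) \<and> M' = (M + 2 ^ j) div 2" for j
        by presburger
      then show ?thesis
        by (auto simp: mask_step_def less_Suc_eq_le)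
    qed
    have "Min (insert penalty (?c ` {M'. mask_step k M M'})) = \<tau> ''best'' 0"
    proof (rule Min_eqI)
      show "finite (insert penalty (?c ` {M'. mask_step k M M'}))"
        using finite_mask_steps by simp
      show "\<tau> ''best'' 0 \<le> y" if "y \<in> insert penalty (?c ` {M'. mask_step k M M'})" for y
        using 6(1) that by (auto simp: step_iff)
      show "\<tau> ''best'' 0 \<in> insert penalty (?c ` {M'. mask_step k M M'})"
        using 6(1) by (cases "\<tau> ''best'' 0 < penalty") auto
    qed
    then have best: "best_cost (m - p) M = card (cover p M) + \<tau> ''best'' 0"
      using p(2) by (simp add: r)
    moreover have "good_successor p M (\<tau> ''nx'' 0)"
      using 6(1) unfolding good_successor_def best by auto
    ultimately show ?case by simp
  qed (use env in \<open>auto simp: eval_infinity\<close>)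
qed

lemma runs_final_penalty:
  assumes "env \<sigma>" and "\<sigma> ''M'' 0 = M"
  shows "runs limit final_penalty \<sigma> (\<lambda>\<tau>. card (cover m M) + \<tau> ''best'' 0 = best_cost 0 M)"
  unfolding final_penalty_def
  by (intro runs_straight) (use assms in \<open>auto simp: eval_infinity eval_start_mask\<close>)

lemma writes_fill_cell [simp]:
  "writes fill_cell = writes analyse \<union> writes best_successor \<union> {''val'', ''next''}"
  by (auto simp: fill_cell_def)

text \<open>Whole-array updates again protect the other cells. In the last layer the entry
  \<open>x\<close> of \<open>next\<close> is left unspecified, since no layer follows.\<close>

lemma runs_fill_cell:
  assumes env: "env \<sigma>" and M: "\<sigma> ''M'' 0 = M" "M < 4 ^ k" and p: "\<sigma> ''p'' 0 = p" "p \<le> m"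
    and val: "p < m \<Longrightarrow> \<forall>M'<4 ^ k. \<sigma> ''val'' (Suc p * 4 ^ k + M') = best_cost (m - Suc p) M'"
  shows "runs limit fill_cell \<sigma> (\<lambda>\<tau>.
    \<tau> ''val'' = (\<sigma> ''val'')(p * 4 ^ k + M := best_cost (m - p) M) \<and>
    (\<exists>x. \<tau> ''next'' = (\<sigma> ''next'')(p * 4 ^ k + M := x) \<and> (p < m \<longrightarrow> good_successor p M x)))"
  unfolding fill_cell_def
proof (rule runs_Seq_frame[OF runs_analyse[OF env M(1) p(1) M(2)]], goal_cases)
  case (1 \<rho>)
  have env': "env \<rho>"
    using 1(2) by (rule env_agree) (use env in auto)
  have state: "\<rho> ''M'' 0 = M" "\<rho> ''p'' 0 = p" "\<rho> ''val'' = \<sigma> ''val''" "\<rho> ''next'' = \<sigma> ''next''"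
    using M(1) p(1) agree_offD[OF 1(2)] by simp_all
  have students: "\<rho> ''students'' 0 = m"
    using env' by (simp add: env_simps)
  have "runs limit (Cond (Less (var ''p'') (var ''students'')) best_successor final_penalty) \<rho>
    (\<lambda>\<tau>. card (cover p M) + \<tau> ''best'' 0 = best_cost (m - p) M \<and>
      (p < m \<longrightarrow> good_successor p M (\<tau> ''nx'' 0)))"
  proof (rule runs_Cond)
    assume "eval_test (Less (var ''p'') (var ''students'')) \<rho>"
    then have "p < m"
      by (simp add: state students)
    then have "\<forall>M'<4 ^ k. \<rho> ''val'' (Suc p * 4 ^ k + M') = best_cost (m - Suc p) M'"
      using val state by simp
    moreover have "\<forall>j\<le>m + 2 * k. \<rho> ''bits'' j = of_bool (bit M j)"
      using 1(1) by (simp add: analysed_def)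
    ultimately show "runs limit best_successor \<rho> (\<lambda>\<tau>. card (cover p M) + \<tau> ''best'' 0 = best_cost (m - p) M \<and>
      (p < m \<longrightarrow> good_successor p M (\<tau> ''nx'' 0)))"
      using runs_conseq[OF runs_best_successor[OF env' state(1) M(2) state(2) \<open>p < m\<close>]] by simp
  next
    assume "\<not> eval_test (Less (var ''p'') (var ''students'')) \<rho>"
    then have "p = m"
      using p(2) by (simp add: state students)
    then show "runs limit final_penalty \<rho> (\<lambda>\<tau>. card (cover p M) + \<tau> ''best'' 0 = best_cost (m - p) M \<and>
      (p < m \<longrightarrow> good_successor p M (\<tau> ''nx'' 0)))"
      using runs_conseq[OF runs_final_penalty[OF env' state(1)]] by simp
  qed
  then show ?case
  proof (rule runs_Seq_frame, goal_cases)
    case best: (1 \<tau>)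
    have "env \<tau>"
      using best(2) by (rule env_agree) (use env' in auto)
    then have "\<tau> ''base'' p = p * 4 ^ k"
      using p(2) by (simp add: env_simps)
    moreover have "\<tau> ''M'' 0 = M" "\<tau> ''p'' 0 = p" "\<tau> ''val'' = \<sigma> ''val''" "\<tau> ''next'' = \<sigma> ''next''"
      "\<tau> ''cnt'' 0 = card (cover p M)"
      using state 1(1) agree_offD[OF best(2)] by (simp_all add: analysed_def)
    ultimately show ?case
      using best(1) by (intro runs_straight) auto
  qed
qed

lemma writes_fill_table [simp]:
  "writes fill_table = writes fill_cell \<union> {''r'', ''p'', ''M''}"
  by (auto simp: fill_table_def)

definition cell_ok :: "store \<Rightarrow> nat \<Rightarrow> nat \<Rightarrow> bool" where
  "cell_ok \<sigma> p M \<longleftrightarrow> \<sigma> ''val'' (p * 4 ^ k + M) = best_cost (m - p) M \<and>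
     (p < m \<longrightarrow> good_successor p M (\<sigma> ''next'' (p * 4 ^ k + M)))"

lemma cell_ok_upd [simp]: "a \<noteq> ''val'' \<Longrightarrow> a \<noteq> ''next'' \<Longrightarrow> cell_ok (\<sigma>(a := f)) = cell_ok \<sigma>"
  by (simp add: cell_ok_def fun_eq_iff)

lemma runs_fill_table:
  assumes "env \<sigma>"
  shows "runs limit fill_table \<sigma> (\<lambda>\<tau>. \<forall>p\<le>m. \<forall>M<4 ^ k. cell_ok \<tau> p M)"
  unfolding fill_table_def
proof (rule runs_For[where n = "m + 1"
      and I = "\<lambda>r \<rho>. \<forall>p\<le>m. m < p + r \<longrightarrow> (\<forall>M<4 ^ k. cell_ok \<rho> p M)"], goal_cases)
  case (2 \<rho>)
  then have "env \<rho>" by (rule env_agree) (use assms in auto)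
  then show ?case by (simp add: env_simps)
next
  case (5 r \<rho>)
  from 5(4) have env: "env \<rho>" by (rule env_agree) (use assms in auto)
  let ?p = "m - r"
  \<comment> \<open>Cells filled so far in the order of computation: all later layers, and the masks
    below \<open>M\<close> in the current one.\<close>
  let ?done = "\<lambda>M p' M'. ?p < p' \<or> p' = ?p \<and> M' < M"
  have pr: "m < p' + r \<longleftrightarrow> ?p < p'" "m < Suc (p' + r) \<longleftrightarrow> ?p \<le> p'" for p'
    using 5(1) by auto
  have "runs limit (For ''M'' (var ''N'') fill_cell) (\<rho>(''p'' := (\<rho> ''p'')(0 := ?p)))
    (\<lambda>\<tau>. \<forall>p'\<le>m. \<forall>M'<4 ^ k. ?done (4 ^ k) p' M' \<longrightarrow> cell_ok \<tau> p' M')"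
  proof (rule runs_For[where n = "4 ^ k" and I = "\<lambda>M \<tau>. \<forall>p'\<le>m. \<forall>M'<4 ^ k. ?done M p' M' \<longrightarrow> cell_ok \<tau> p' M'"],
      goal_cases)
    case (2 \<tau>)
    then have "env \<tau>" by (rule env_agree) (use env in auto)
    then show ?case by (simp add: env_simps)
  next
    case 4
    then show ?case using 5(2) pr by simp
  next
    case body: (5 M \<tau>)
    from body(4) have env': "env \<tau>" by (rule env_agree) (use env in auto)
    have p: "\<tau> ''p'' 0 = ?p"
      using agree_offD[OF body(4)] by simp
    have val: "\<forall>M'<4 ^ k. \<tau> ''val'' (Suc ?p * 4 ^ k + M') = best_cost (m - Suc ?p) M'" if "?p < m"
      using body(2) that unfolding cell_ok_def by (metis Suc_leI lessI)
    show ?case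
    proof (rule runs_conseq[OF runs_fill_cell[OF env' body(3,1) p _ val]], simp, assumption, goal_cases)
      case (1 \<upsilon>)
      then obtain x where val': "\<upsilon> ''val'' = (\<tau> ''val'')(?p * 4 ^ k + M := best_cost (m - ?p) M)"
        and nx: "\<upsilon> ''next'' = (\<tau> ''next'')(?p * 4 ^ k + M := x)" "?p < m \<longrightarrow> good_successor ?p M x"
        by blast
      have "cell_ok \<upsilon> p' M'" if "p' \<le> m" "M' < 4 ^ k" "?done (Suc M) p' M'" for p' M'
      proof (cases "p' = ?p \<and> M' = M")
        case True
        with val' nx show ?thesis
          by (simp add: cell_ok_def)
      next
        case False
        then have "cell_ok \<tau> p' M'"
          using body(2) that by auto
        then show ?thesis
          using val' nx(1) cell_eq_iff[OF that(2) body(1), of p' ?p] False by (auto simp: cell_ok_def)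
      qed
      then show ?case by simp
    qed
  qed (use 5 in auto)
  then have "runs limit (For ''M'' (var ''N'') fill_cell) (\<rho>(''p'' := (\<rho> ''p'')(0 := ?p)))
    (\<lambda>\<tau>. \<forall>p'\<le>m. m < p' + Suc r \<longrightarrow> (\<forall>M'<4 ^ k. cell_ok \<tau> p' M'))"
    by (rule runs_conseq) (auto simp: pr le_less)
  then show ?case
    using env 5(3) by (intro runs_Seq runs_Assign) (simp add: env_simps)
qed auto

section \<open>Tables of multiples, powers and halves\<close>

lemma input_simps:
  assumes "input_ok \<sigma>"
  shows "\<sigma> ''students'' 0 = m" "\<sigma> ''questions'' 0 = w" "\<sigma> ''k'' 0 = k"
  using assms by (simp_all add: input_ok_def)

lemma input_agree:
  assumes "agree_off W \<sigma> \<tau>" and "W \<inter> {''students'', ''questions'', ''k'', ''alpha'', ''adj''} = {}"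
    and "input_ok \<sigma>"
  shows "input_ok \<tau>"
proof -
  have eq: "\<tau> a = \<sigma> a" if "a \<in> {''students'', ''questions'', ''k'', ''alpha'', ''adj''}" for a
    using agree_offD[OF assms(1)] assms(2) that by blast
  show ?thesis
    using assms(3) unfolding input_ok_def by (simp add: eq)
qed

lemma input_upd [simp]:
  assumes "a \<notin> {''students'', ''questions'', ''k'', ''alpha'', ''adj''}" and "input_ok \<sigma>"
  shows "input_ok (\<sigma>(a := f))"
proof (rule input_agree[OF _ _ assms(2)])
  show "agree_off {a} \<sigma> (\<sigma>(a := f))"
    by (simp add: agree_off_def)
qed (use assms in blast)

lemma runs_row_table:
  assumes "input_ok \<sigma>" and "\<sigma> ''row'' 0 = 0"
  shows "runs limit row_table \<sigma> (\<lambda>\<tau>. \<forall>i\<le>m + 1. \<tau> ''row'' i = i * w)"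
  unfolding row_table_def
proof (rule runs_For[where n = "m + 1" and I = "\<lambda>i \<rho>. \<forall>i'\<le>i. \<rho> ''row'' i' = i' * w"], goal_cases)
  case (2 \<rho>)
  then have "input_ok \<rho>" by (rule input_agree) (use assms in auto)
  then show ?case by (simp add: input_simps)
next
  case (5 i \<rho>)
  from 5(4) have "input_ok \<rho>" by (rule input_agree) (use assms in auto)
  with 5(2,3) show ?case
    by (intro runs_straight) (auto simp: input_simps le_Suc_eq)
qed (use assms in auto)

lemma runs_pow_table:
  assumes "input_ok \<sigma>"
  shows "runs limit pow_table \<sigma> (\<lambda>\<tau>. \<forall>i\<le>2 * k. \<tau> ''pow'' i = 2 ^ i)"
  unfolding pow_table_def
proof (intro runs_Seq runs_Assign,
    rule runs_For[where n = "2 * k" and I = "\<lambda>i \<rho>. \<forall>i'\<le>i. \<rho> ''pow'' i' = 2 ^ i'"], goal_cases)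
  case (2 \<rho>)
  then have "input_ok \<rho>" by (rule input_agree) (use assms in auto)
  then show ?case by (simp add: input_simps)
next
  case (5 i \<rho>)
  then show ?case
    by (intro runs_straight) (auto simp: le_Suc_eq)
qed (use assms in auto)

lemma runs_half_table:
  assumes "input_ok \<sigma>" and "\<forall>i\<le>2 * k. \<sigma> ''pow'' i = 2 ^ i"
  shows "runs limit half_table \<sigma> (\<lambda>\<tau>. \<tau> ''N'' 0 = 4 ^ k \<and> (\<forall>x<2 * 4 ^ k. \<tau> ''half'' x = x div 2))"
  unfolding half_table_def
proof (intro runs_Seq runs_Assign,
    rule runs_For[where n = "4 ^ k" and I = "\<lambda>h \<rho>. \<forall>x<2 * h. \<rho> ''half'' x = x div 2"], goal_cases)
  have pow: "\<sigma> ''pow'' (k + k) = 4 ^ k"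
    using assms(2) by (simp add: mult_2[symmetric] power_mult)
  {
    case (2 \<rho>)
    show ?case
      using agree_offD[OF 2, of "''N''"] pow by (simp add: input_simps[OF assms(1)])
  next
    case (6 \<tau>)
    show ?case
      using 6(1) agree_offD[OF 6(2), of "''N''"] pow by (simp add: input_simps[OF assms(1)])
  }
next
  case (5 h \<rho>)
  have "x < 2 * h \<or> x = h + h \<or> x = Suc (h + h)" if "x < 2 * Suc h" for x
    using that by auto
  with 5(2,3) show ?case
    by (intro runs_straight) auto
qed auto

lemma runs_base_table:
  assumes "input_ok \<sigma>" and "\<sigma> ''N'' 0 = 4 ^ k" and "\<sigma> ''base'' 0 = 0"
  shows "runs limit base_table \<sigma> (\<lambda>\<tau>. \<forall>i\<le>m + 1. \<tau> ''base'' i = i * 4 ^ k)"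
  unfolding base_table_def
proof (rule runs_For[where n = "m + 1" and I = "\<lambda>i \<rho>. \<forall>i'\<le>i. \<rho> ''base'' i' = i' * 4 ^ k"], goal_cases)
  case (2 \<rho>)
  then have "input_ok \<rho>" by (rule input_agree) (use assms in auto)
  then show ?case by (simp add: input_simps)
next
  case (5 i \<rho>)
  have "\<rho> ''N'' 0 = 4 ^ k"
    using agree_offD[OF 5(4)] assms(2) by simp
  with 5(2,3) show ?case
    by (intro runs_straight) (auto simp: le_Suc_eq)
qed (use assms in auto)

lemma writes_tables [simp]:
  "writes row_table = {''i'', ''row''}" "writes pow_table = {''pow'', ''d''}"
  "writes half_table = {''N'', ''h'', ''half''}" "writes base_table = {''i'', ''base''}"
  by (auto simp: row_table_def pow_table_def half_table_def base_table_def)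

lemma runs_tables:
  assumes input: "input_ok \<sigma>" and "\<sigma> ''row'' 0 = 0" and "\<sigma> ''base'' 0 = 0"
  shows "runs limit tables \<sigma> env"
  unfolding tables_def
proof (rule runs_Seq_frame[OF runs_row_table[OF input assms(2)]], goal_cases)
  case row: (1 \<sigma>1)
  have in1: "input_ok \<sigma>1"
    using row(2) by (rule input_agree) (use input in auto)
  show ?case
  proof (rule runs_Seq_frame[OF runs_pow_table[OF in1]], goal_cases)
    case pow: (1 \<sigma>2)
    have in2: "input_ok \<sigma>2"
      using pow(2) by (rule input_agree) (use in1 in auto)
    show ?case
    proof (rule runs_Seq_frame[OF runs_half_table[OF in2 pow(1)]], goal_cases)
      case half: (1 \<sigma>3)
      have in3: "input_ok \<sigma>3"
        using half(2) by (rule input_agree) (use in2 in auto)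
      have N: "\<sigma>3 ''N'' 0 = 4 ^ k"
        using half(1) by simp
      have b0: "\<sigma>3 ''base'' 0 = 0"
        using assms(3) agree_offD[OF row(2)] agree_offD[OF pow(2)] agree_offD[OF half(2)] by simp
      show ?case
      proof (rule runs_conseq[OF runs_base_table[OF in3 N b0]], goal_cases)
        case base: (1 \<tau>)
        have "input_ok \<tau>"
          using base(2) by (rule input_agree) (use in3 in auto)
        moreover have "\<tau> ''row'' = \<sigma>1 ''row''" "\<tau> ''pow'' = \<sigma>2 ''pow''" "\<tau> ''N'' = \<sigma>3 ''N''"
          "\<tau> ''half'' = \<sigma>3 ''half''"
          using agree_offD[OF base(2)] agree_offD[OF half(2)] agree_offD[OF pow(2)] by simp_all
        ultimately show ?case
          using row(1) pow(1) half(1) base(1) by (simp add: env_def tables_ok_def)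
      qed
    qed
  qed
qed

section \<open>Reading off the added edges\<close>

text \<open>Shared by \<open>all_nonedges\<close> and \<open>prune\<close>. The function
  \<open>h\<close> receives the old entry because pruning must preserve the cells that it does not
  clear.\<close>

lemma runs_matrix_loop:
  assumes env: "env \<sigma>" and writes: "writes body = {''out''}"
    and body: "\<And>i q \<rho>. i < m \<Longrightarrow> q < w \<Longrightarrow> env \<rho> \<Longrightarrow> \<rho> ''i'' 0 = i \<Longrightarrow> \<rho> ''q'' 0 = q \<Longrightarrow>
      agree_off {''i'', ''q'', ''out''} \<sigma> \<rho> \<Longrightarrow>
      runs limit body \<rho> (\<lambda>\<tau>. \<tau> ''out'' = (\<rho> ''out'')(i * w + q := h i q (\<rho> ''out'' (i * w + q))))"
  shows "runs limit (For ''i'' (var ''students'') (For ''q'' (var ''questions'') body)) \<sigma>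
    (\<lambda>\<tau>. \<forall>i<m. \<forall>q<w. \<tau> ''out'' (i * w + q) = h i q (\<sigma> ''out'' (i * w + q)))"
proof -
  let ?I = "\<lambda>i q \<rho>. \<forall>i'<m. \<forall>q'<w. \<rho> ''out'' (i' * w + q') =
    (if i' < i \<or> i' = i \<and> q' < q then h i' q' (\<sigma> ''out'' (i' * w + q')) else \<sigma> ''out'' (i' * w + q'))"
  show ?thesis
  proof (rule runs_For[where n = m and I = "\<lambda>i. ?I i 0"], goal_cases)
    case (2 \<rho>)
    then have "env \<rho>" by (rule env_agree) (use env writes in auto)
    then show ?case by (simp add: env_simps)
  next
    case (5 i \<rho>)
    from 5(4) have env': "env \<rho>" by (rule env_agree) (use env writes in auto)
    show ?case
    proof (rule runs_For[where n = w and I = "?I i"], goal_cases)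
      case (2 \<tau>)
      then have "env \<tau>" by (rule env_agree) (use env' writes in auto)
      then show ?case by (simp add: env_simps)
    next
      case cell: (5 q \<tau>)
      from cell(4) have env'': "env \<tau>" by (rule env_agree) (use env' writes in auto)
      have i: "\<tau> ''i'' 0 = i"
        using agree_offD[OF cell(4)] 5(3) writes by simp
      have ag: "agree_off {''i'', ''q'', ''out''} \<sigma> \<tau>"
        using cell(4) 5(4) writes by (auto simp: agree_off_def)
      show ?case
      proof (rule runs_conseq[OF body[OF 5(1) cell(1) env'' i cell(3) ag]], goal_cases)
        case (1 \<upsilon>)
        have "\<upsilon> ''out'' (i' * w + q') =
          (if i' < i \<or> i' = i \<and> q' < Suc q then h i' q' (\<sigma> ''out'' (i' * w + q'))
           else \<sigma> ''out'' (i' * w + q'))" if "i' < m" "q' < w" for i' q'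
        proof (cases "i' = i \<and> q' = q")
          case True
          then show ?thesis using 1(1) cell(2) that by simp
        next
          case False
          then have "\<upsilon> ''out'' (i' * w + q') = \<tau> ''out'' (i' * w + q')"
            using 1(1) cell_eq_iff[OF that(2) cell(1), of i' i] by auto
          also have "\<dots> = (if i' < i \<or> i' = i \<and> q' < Suc q then h i' q' (\<sigma> ''out'' (i' * w + q'))
            else \<sigma> ''out'' (i' * w + q'))"
            using cell(2) that False by (auto simp: less_Suc_eq)
          finally show ?thesis .
        qed
        then show ?case by simp
      qed
    next
      case (6 \<tau>)
      have "i' < Suc i \<longleftrightarrow> i' < i \<or> i' = i" for i'
        by auto
      with 6(1) show ?case by simp
    qed (use 5 writes in auto)
  qed (use writes in auto)
qed

lemma runs_all_nonedges:
  assumes "env \<sigma>"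
  shows "runs limit all_nonedges \<sigma>
    (\<lambda>\<tau>. \<forall>i<m. \<forall>q<w. \<tau> ''out'' (i * w + q) = of_bool ((xs ! i, ys ! q) \<notin> E))"
  unfolding all_nonedges_def
  by (rule runs_matrix_loop[OF assms, where h = "\<lambda>i q _. of_bool ((xs ! i, ys ! q) \<notin> E)"])
    (auto intro!: runs_straight simp: env_simps)

lemma runs_prune:
  assumes "env \<sigma>" and "analysed p M \<sigma>"
  shows "runs limit prune \<sigma> (\<lambda>\<tau>. \<forall>i<m. \<forall>q<w. \<tau> ''out'' (i * w + q) =
    (if pos (xs ! i) \<in> placed p M \<and> ys ! q \<notin> cover p M then 0 else \<sigma> ''out'' (i * w + q)))"
  unfolding prune_def
proof (rule runs_matrix_loop[OF assms(1), where h = "\<lambda>i q old.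
    if pos (xs ! i) \<in> placed p M \<and> ys ! q \<notin> cover p M then 0 else old"], goal_cases)
  case (2 i q \<rho>)
  have "\<rho> ''mem'' i = of_bool (pos (xs ! i) \<in> placed p M)" "\<rho> ''un'' q = of_bool (ys ! q \<in> cover p M)"
    using assms(2) 2(1,2) agree_offD[OF 2(6)] by (simp_all add: analysed_def)
  with 2 show ?case
    by (intro runs_straight) (auto simp: env_simps)
qed auto

lemma writes_prune [simp]: "writes prune = {''i'', ''q'', ''out''}"
  and writes_all_nonedges [simp]: "writes all_nonedges = {''i'', ''q'', ''out''}"
  by (auto simp: prune_def all_nonedges_def)

lemma runs_follow_path:
  assumes env: "env \<sigma>" and cells: "\<forall>p\<le>m. \<forall>M<4 ^ k. cell_ok \<sigma> p M"
    and out: "\<forall>i<m. \<forall>q<w. \<sigma> ''out'' (i * w + q) = of_bool ((xs ! i, ys ! q) \<notin> E)"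
  shows "runs limit follow_path \<sigma>
    (\<lambda>\<tau>. min_near_chain_addition S Q E \<alpha> k (output_edges xs ys \<tau>))"
proof -
  define f where "f = follow (\<lambda>p M. \<sigma> ''next'' (p * 4 ^ k + M))"
  have good: "good_successor p M (\<sigma> ''next'' (p * 4 ^ k + M))" if "p < m" "M < 4 ^ k" for p M
    using cells that by (simp add: cell_ok_def)
  note opt = follow_optimal[of "\<lambda>p M. \<sigma> ''next'' (p * 4 ^ k + M)", OF good, folded f_def]
  \<comment> \<open>The condition defining \<open>path_edges\<close>, restricted to times before
    \<open>p\<close>; at \<open>p = m + 1\<close> it is the full one.\<close>
  let ?keep = "\<lambda>p i q. (xs ! i, ys ! q) \<notin> E \<and>
    (\<forall>p'<p. pos (xs ! i) \<in> placed p' (f p') \<longrightarrow> ys ! q \<in> cover p' (f p'))"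
  show ?thesis
    unfolding follow_path_def
  proof (intro runs_Seq runs_Assign, rule runs_For[where n = "m + 1" and I = "\<lambda>p \<rho>. \<rho> ''M'' 0 = f p \<and>
        (\<forall>i<m. \<forall>q<w. \<rho> ''out'' (i * w + q) = of_bool (?keep p i q))"], goal_cases)
    case (2 \<rho>)
    then have "env \<rho>" by (rule env_agree) (use env in auto)
    then show ?case by (simp add: env_simps)
  next
    case 4
    show ?case
      using out by (simp add: f_def eval_start_mask[OF env])
  next
    case (5 p \<rho>)
    from 5(4) have env': "env \<rho>" by (rule env_agree) (use env in auto)
    have less: "f p < 4 ^ k"
      using opt(3) 5(1) by simp
    have M: "\<rho> ''M'' 0 = f p"
      using 5(2) by simp
    show ?case
    proof (rule runs_Seq_frame[OF runs_analyse[OF env' M 5(3) less]], goal_cases)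
      case an: (1 \<tau>)
      have env'': "env \<tau>"
        using an(2) by (rule env_agree) (use env' in auto)
      show ?case
      proof (rule runs_Seq_frame[OF runs_prune[OF env'' an(1)]], rule runs_Assign, goal_cases)
        case pr: (1 \<upsilon>)
        have "env \<upsilon>"
          using pr(2) by (rule env_agree) (use env'' in auto)
        then have base: "\<upsilon> ''base'' p = p * 4 ^ k"
          using 5(1) by (simp add: env_simps)
        have state: "\<upsilon> ''p'' 0 = p" "\<upsilon> ''M'' 0 = f p" "\<upsilon> ''next'' = \<sigma> ''next''" "\<tau> ''out'' = \<rho> ''out''"
          using agree_offD[OF pr(2)] agree_offD[OF an(2)] agree_offD[OF 5(4)] M 5(3) by simp_all
        \<comment> \<open>For \<open>p = m\<close> this names a mask one step past the path, which
          \<open>path_edges\<close> does not consult.\<close>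
        have "f (Suc p) = \<sigma> ''next'' (p * 4 ^ k + f p)"
          by (simp add: f_def)
        moreover have "\<upsilon> ''out'' (i * w + q) = of_bool (?keep (Suc p) i q)" if "i < m" "q < w" for i q
          using pr(1) 5(2) state(4) that by (auto simp: less_Suc_eq)
        ultimately show ?case
          by (simp add: state base)
      qed
    qed
  next
    case (6 \<tau>)
    have keep: "?keep (m + 1) i q \<longleftrightarrow> (xs ! i, ys ! q) \<in> path_edges f" if "i < m" "q < w" for i q
      using that xs(2) ys(2) by (auto simp: path_edges_def less_Suc_eq_le)
    have cell: "\<tau> ''out'' (i * w + q) = Suc 0 \<longleftrightarrow> (xs ! i, ys ! q) \<in> path_edges f"
      if "i < m" "q < w" for i q
      using 6(1) that unfolding keep[OF that, symmetric] by simp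
    have "output_edges xs ys \<tau> = {(xs ! i, ys ! q) | i q. i < m \<and> q < w \<and> (xs ! i, ys ! q) \<in> path_edges f}"
      by (simp add: output_edges_def cell cong: conj_cong)
    also have "\<dots> = path_edges f"
    proof -
      have "path_edges f \<subseteq> set xs \<times> set ys"
        using xs(2) ys(2) by (auto simp: path_edges_def)
      then show ?thesis
        by (fastforce simp: in_set_conv_nth)
    qed
    finally show ?case
      using path_edges_minimal[OF opt(1,2)] by simp
  qed (use env in auto)
qed

lemma runs_solver:
  "runs limit solver (input_store xs ys E \<alpha> k)
     (\<lambda>\<tau>. min_near_chain_addition S Q E \<alpha> k (output_edges xs ys \<tau>))"
  unfolding solver_def
proof (rule runs_Seq_frame[OF runs_tables], goal_cases)
  case 1
  have "i * w + q < m * w" if "i < m" "q < w" for i q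
  proof -
    have "i * w + q < Suc i * w"
      using that by simp
    also have "\<dots> \<le> m * w"
      using that by (intro mult_le_mono1) simp
    finally show ?thesis .
  qed
  moreover have "(i * w + q) div w = i" if "q < w" for i q
    using that by (cases "ys = []") simp_all
  ultimately show ?case
    by (auto simp: input_ok_def input_store_def)
next
  case (4 \<sigma>)
  show ?case
  proof (rule runs_Seq_frame[OF runs_fill_table[OF 4(1)]], goal_cases)
    case fill: (1 \<rho>)
    have env: "env \<rho>"
      using fill(2) by (rule env_agree) (use 4(1) in auto)
    show ?case
    proof (rule runs_Seq_frame[OF runs_all_nonedges[OF env]], goal_cases)
      case (1 \<tau>)
      have "env \<tau>"
        using 1(2) by (rule env_agree) (use env in auto)
      moreover have "\<forall>p\<le>m. \<forall>M<4 ^ k. cell_ok \<tau> p M"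
        using fill(1) agree_offD[OF 1(2)] by (simp add: cell_ok_def)
      ultimately show ?case
        using 1(1) by (rule runs_follow_path)
    qed
  qed
qed (simp_all add: input_store_def)


section \<open>Running time\<close>

lemma time_bound_solver:
  "time_bound limit solver \<le> 1000 * ((m + 1) * (m + 1) * (w + 1) * (k + 1) * 4 ^ k)"
proof -
  define N :: nat where "N = 4 ^ k"
  have "1 \<le> N"
    by (simp add: N_def)
  \<comment> \<open>The bound is linear in monomials. Those from the tables and the replay may lack
    the factor \<open>N\<close> and are compared with their multiples by \<open>N\<close>.\<close>
  then have N: "x \<le> N * x" for x
    by simp
  show ?thesis
    by (simp add: solver_def tables_def row_table_def pow_table_def half_table_def
        base_table_def fill_table_def fill_cell_def analyse_def decode_def mark_members_def
        count_union_def test_cover_def best_successor_def final_penalty_def infinity_def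
        start_mask_def all_nonedges_def follow_path_def prune_def N_def[symmetric] algebra_simps)
      (use N[of 1] N[of m] N[of w] N[of k] N[of "m * w"] N[of "k * m"] N[of "m * m"] N[of "m * (m * w)"]
        in linarith)
qed

end

text \<open>From \<open>k = 2\<close> on, \<open>4 ^ k = 2 ^ (2 * k) \<le> k ^ (2 * k)\<close>, and
  the extra factor \<open>k ^ 2\<close> absorbs \<open>k + 1\<close>. The constant 8 is forced by
  \<open>k = 1\<close>, where the power of \<open>k\<close> is 1.\<close>

lemma four_power_le:
  fixes k :: nat
  assumes "0 < k"
  shows "(k + 1) * 4 ^ k \<le> 8 * k ^ (2 * k + 2)"
proof (cases "k = 1")
  case False
  then have k: "2 \<le> k"
    using assms by simp
  have "4 ^ k = (2::nat) ^ (2 * k)"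
    by (simp add: power_mult)
  also have "\<dots> \<le> k ^ (2 * k)"
    using k by (rule power_mono) simp
  finally have "4 ^ k \<le> k ^ (2 * k)" .
  moreover have "k + 1 \<le> 8 * k ^ 2"
    using k le_square[of k] unfolding power2_eq_square by linarith
  ultimately have "(k + 1) * 4 ^ k \<le> (8 * k ^ 2) * k ^ (2 * k)"
    by (rule mult_le_mono[rotated])
  then show ?thesis
    by (simp only: power_add mult_ac)
qed simp

theorem theorem3:
  "\<exists>(prog :: com) (C :: nat).
     \<forall>(S :: nat set) (Q :: nat set) (E :: (nat \<times> nat) set) (\<alpha> :: nat \<Rightarrow> nat) (k :: nat)
      (xs :: nat list) (ys :: nat list).
       near_chain_instance S Q E \<alpha> k \<and>
       distinct xs \<and> set xs = S \<and> distinct ys \<and> set ys = Q \<longrightarrow>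
       (\<exists>t \<tau>. exec prog (input_store xs ys E \<alpha> k) t \<tau> \<and>
              min_near_chain_addition S Q E \<alpha> k (output_edges xs ys \<tau>) \<and>
              (let n = card S + card Q in
                 n \<ge> 1 \<longrightarrow> t \<le> C * (n ^ 3 * k ^ (2 * k + 2))))"
proof (rule exI[of _ solver], rule exI[of _ "64000"], intro allI impI, elim conjE)
  fix S Q :: "nat set" and E :: "(nat \<times> nat) set" and \<alpha> :: "nat \<Rightarrow> nat" and k :: nat
    and xs ys :: "nat list"
  assume inst: "near_chain_instance S Q E \<alpha> k"
    "distinct xs" "set xs = S" "distinct ys" "set ys = Q"
  then interpret near_chain S Q E \<alpha> k xs ys
    by unfold_locales
  obtain t \<tau> where exec: "exec solver (input_store xs ys E \<alpha> k) t \<tau>"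
    and t: "t \<le> time_bound limit solver"
    and min: "min_near_chain_addition S Q E \<alpha> k (output_edges xs ys \<tau>)"
    using runs_solver by (auto simp: runs_def)
  \<comment> \<open>The constant is \<open>1000 * 2 ^ 3 * 8\<close>: the program bound, three
    factors at most \<open>2 * n\<close> (as \<open>n \<ge> 1\<close>), and
    \<open>four_power_le\<close>.\<close>
  have "t \<le> 64000 * (n ^ 3 * k ^ (2 * k + 2))" if n: "n = card S + card Q" "n \<ge> 1" for n
  proof -
    have "m + 1 \<le> 2 * n" "w + 1 \<le> 2 * n"
      using n by (simp_all add: card_S card_Q)
    then have "(m + 1) * (m + 1) * (w + 1) \<le> (2 * n) * (2 * n) * (2 * n)"
      by (intro mult_le_mono)
    then have "((m + 1) * (m + 1) * (w + 1)) * ((k + 1) * 4 ^ k)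
        \<le> ((2 * n) * (2 * n) * (2 * n)) * (8 * k ^ (2 * k + 2))"
      using four_power_le[OF k_pos] by (rule mult_le_mono)
    also have "\<dots> = 64 * (n ^ 3 * k ^ (2 * k + 2))"
      by (simp add: power3_eq_cube)
    finally have "(m + 1) * (m + 1) * (w + 1) * (k + 1) * 4 ^ k \<le> 64 * (n ^ 3 * k ^ (2 * k + 2))"
      by (simp only: mult.assoc)
    with t time_bound_solver show ?thesis
      by linarith
  qed
  with exec min show "\<exists>t \<tau>. exec solver (input_store xs ys E \<alpha> k) t \<tau> \<and>
      min_near_chain_addition S Q E \<alpha> k (output_edges xs ys \<tau>) \<and>
      (let n = card S + card Q in n \<ge> 1 \<longrightarrow> t \<le> 64000 * (n ^ 3 * k ^ (2 * k + 2)))"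
    by (auto simp: Let_def)
qed

end
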